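(* The inclusion functor $G_4:\mathrm{CMon}_s\to\mathrm{PMon}_s$, from the $2$-category of complete monoids to the $2$-category of right powder monoids (both with continuous semigroup homomorphisms as $1$-morphisms and conjugations as $2$-morphisms), has a left adjoint.
   Context: Adjoints are in the sense of strict $2$-adjunctions: isomorphisms of hom-categories $\mathrm{Hom}(FX,Y)\cong\mathrm{Hom}(X,GY)$, natural in $X$ and $Y$. Semigroup homomorphisms between monoids need not preserve identities. A conjugation $\alpha:\phi\Rightarrow\psi$ between semigroup homomorphisms $\phi,\psi:M\to M'$ is an element $\alpha\in M'$ with $\alpha\phi(1)=\alpha=\psi(1)\alpha$ and $\alpha\phi(m)=\psi(m)\alpha$ for all $m\in M$. For a monoid $M$, $A\subseteq M$, $p\in M$: $p^*(A)=\{m\mid pm\in A\}$, $\mathcal{I}_A^p=\{m\mid m^*(A)=p^*(A)\}$. A topology $\tau$ on $M$ is an action topology if it coincides with the topology having base $\{A\mid\forall p,q\in M,\ \mathcal{I}^p_{q^*(A)}\in\tau\}$. A right powder monoid is a $T_0$ topological monoid whose topology is an action topology. An $(M,\tau)$-set is a right $M$-set $X$ whose action $X\times M\to X$ is continuous when $X$ is discrete. Complete monoids: for a topological monoid $(M,\tau)$ let $\mathcal{R}_\tau$ be the inclusion-ordered set of right congruences $r$ on $M$ (equivalence relations with $(p,q)\in r\Rightarrow(pm,qm)\in r$) such that $M/r$ is an $(M,\tau)$-set; let $L=\varprojlim_{r\in\mathcal{R}_\tau}M/r$ with product $([a_r])_r([b_r])_r=([a_r\,b_{a_r^*(r)}])_r$,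 where $m^*(r)=\{(x,y)\mid(mx,my)\in r\}$, with $\rho$ the coarsest topology making the projections to the discrete sets $M/r$ continuous, and $u:M\to L$, $u(m)=([m])_r$. $(M,\tau)$ is complete if $u:(M,\tau)\to(L,\rho)$ is an isomorphism of topological monoids; complete monoids are powder monoids, and $\mathrm{CMon}_s$ is a full sub-$2$-category of $\mathrm{PMon}_s$. *)

theory Defs
  imports "HOL-Analysis.Analysis" "HOL-Algebra.Group" "HOL-Library.Equipollence"
begin

section \<open>Strict 2-categories and strict 2-adjunctions\<close>

record ('m, 'c) cat =
  Ob :: "'m set"
  Ar :: "'c set"
  src :: "'c \<Rightarrow> 'm"
  tgt :: "'c \<Rightarrow> 'm"
  ide :: "'m \<Rightarrow> 'c"
  cmp :: "'c \<Rightarrow> 'c \<Rightarrow> 'c"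

definition is_category :: "('m, 'c) cat \<Rightarrow> bool" where
  "is_category C \<longleftrightarrow>
     (\<forall>a\<in>Ar C. src C a \<in> Ob C \<and> tgt C a \<in> Ob C) \<and>
     (\<forall>x\<in>Ob C. ide C x \<in> Ar C \<and> src C (ide C x) = x \<and> tgt C (ide C x) = x) \<and>
     (\<forall>a\<in>Ar C. \<forall>b\<in>Ar C. src C b = tgt C a \<longrightarrow>
        cmp C b a \<in> Ar C \<and> src C (cmp C b a) = src C a \<and> tgt C (cmp C b a) = tgt C b) \<and>
     (\<forall>a\<in>Ar C. cmp C a (ide C (src C a)) = a \<and> cmp C (ide C (tgt C a)) a = a) \<and>
     (\<forall>a\<in>Ar C. \<forall>b\<in>Ar C. \<forall>c\<in>Ar C. src C b = tgt C a \<and> src C c = tgt C b \<longrightarrow>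
        cmp C c (cmp C b a) = cmp C (cmp C c b) a)"

definition is_cat_functor ::
    "('m, 'c) cat \<Rightarrow> ('n, 'd) cat \<Rightarrow> ('m \<Rightarrow> 'n) \<Rightarrow> ('c \<Rightarrow> 'd) \<Rightarrow> bool" where
  "is_cat_functor C D F0 F1 \<longleftrightarrow>
     is_category C \<and> is_category D \<and>
     (\<forall>x\<in>Ob C. F0 x \<in> Ob D \<and> F1 (ide C x) = ide D (F0 x)) \<and>
     (\<forall>a\<in>Ar C. F1 a \<in> Ar D \<and> src D (F1 a) = F0 (src C a) \<and> tgt D (F1 a) = F0 (tgt C a)) \<and>
     (\<forall>a\<in>Ar C. \<forall>b\<in>Ar C. src C b = tgt C a \<longrightarrow> F1 (cmp C b a) = cmp D (F1 b) (F1 a))"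

definition is_cat_iso ::
    "('m, 'c) cat \<Rightarrow> ('n, 'd) cat \<Rightarrow> ('m \<Rightarrow> 'n) \<Rightarrow> ('c \<Rightarrow> 'd) \<Rightarrow> bool" where
  "is_cat_iso C D F0 F1 \<longleftrightarrow>
     is_cat_functor C D F0 F1 \<and> bij_betw F0 (Ob C) (Ob D) \<and> bij_betw F1 (Ar C) (Ar D)"

definition prod_cat :: "('m, 'c) cat \<Rightarrow> ('n, 'd) cat \<Rightarrow> ('m \<times> 'n, 'c \<times> 'd) cat" where
  "prod_cat C D =
     \<lparr>Ob = Ob C \<times> Ob D,
      Ar = Ar C \<times> Ar D,
      src = map_prod (src C) (src D),
      tgt = map_prod (tgt C) (tgt D),
      ide = map_prod (ide C) (ide D),
      cmp = (\<lambda>(b, b') (a, a'). (cmp C b a, cmp D b' a'))\<rparr>"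

text \<open>A strict 2-category is a Cat-enriched category. In \<open>comp1 C X Y Z g f\<close> and
  \<open>comp2 C X Y Z b a\<close> the cells \<open>f\<close>, \<open>a\<close> live in \<open>Hom C X Y\<close> and \<open>g\<close>, \<open>b\<close> in
  \<open>Hom C Y Z\<close>; \<open>comp2\<close> is horizontal composition, vertical composition is \<open>cmp (Hom C X Y)\<close>.\<close>

record ('o, 'm, 'c) two_cat =
  Obj :: "'o set"
  Hom :: "'o \<Rightarrow> 'o \<Rightarrow> ('m, 'c) cat"
  id1 :: "'o \<Rightarrow> 'm"
  comp1 :: "'o \<Rightarrow> 'o \<Rightarrow> 'o \<Rightarrow> 'm \<Rightarrow> 'm \<Rightarrow> 'm"
  comp2 :: "'o \<Rightarrow> 'o \<Rightarrow> 'o \<Rightarrow> 'c \<Rightarrow> 'c \<Rightarrow> 'c"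

definition strict_2_category :: "('o, 'm, 'c) two_cat \<Rightarrow> bool" where
  "strict_2_category C \<longleftrightarrow>
     (\<forall>X\<in>Obj C. \<forall>Y\<in>Obj C. is_category (Hom C X Y)) \<and>
     (\<forall>X\<in>Obj C. id1 C X \<in> Ob (Hom C X X)) \<and>
     (\<forall>X\<in>Obj C. \<forall>Y\<in>Obj C. \<forall>Z\<in>Obj C.
        is_cat_functor (prod_cat (Hom C Y Z) (Hom C X Y)) (Hom C X Z)
          (\<lambda>(g, f). comp1 C X Y Z g f) (\<lambda>(b, a). comp2 C X Y Z b a)) \<and>
     (\<forall>X\<in>Obj C. \<forall>Y\<in>Obj C.
        (\<forall>f\<in>Ob (Hom C X Y). comp1 C X X Y f (id1 C X) = f \<and> comp1 C X Y Y (id1 C Y) f = f) \<and>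
        (\<forall>a\<in>Ar (Hom C X Y).
           comp2 C X X Y a (ide (Hom C X X) (id1 C X)) = a \<and>
           comp2 C X Y Y (ide (Hom C Y Y) (id1 C Y)) a = a)) \<and>
     (\<forall>W\<in>Obj C. \<forall>X\<in>Obj C. \<forall>Y\<in>Obj C. \<forall>Z\<in>Obj C.
        (\<forall>f\<in>Ob (Hom C W X). \<forall>g\<in>Ob (Hom C X Y). \<forall>h\<in>Ob (Hom C Y Z).
           comp1 C W Y Z h (comp1 C W X Y g f) = comp1 C W X Z (comp1 C X Y Z h g) f) \<and>
        (\<forall>a\<in>Ar (Hom C W X). \<forall>b\<in>Ar (Hom C X Y). \<forall>c\<in>Ar (Hom C Y Z).
           comp2 C W Y Z c (comp2 C W X Y b a) = comp2 C W X Z (comp2 C X Y Z c b) a))"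

record ('o, 'm, 'c, 'o2, 'm2, 'c2) two_functor =
  on0 :: "'o \<Rightarrow> 'o2"
  on1 :: "'o \<Rightarrow> 'o \<Rightarrow> 'm \<Rightarrow> 'm2"
  on2 :: "'o \<Rightarrow> 'o \<Rightarrow> 'c \<Rightarrow> 'c2"

definition strict_2_functor ::
    "('o, 'm, 'c) two_cat \<Rightarrow> ('o2, 'm2, 'c2) two_cat
     \<Rightarrow> ('o, 'm, 'c, 'o2, 'm2, 'c2) two_functor \<Rightarrow> bool" where
  "strict_2_functor C D F \<longleftrightarrow>
     strict_2_category C \<and> strict_2_category D \<and>
     (\<forall>X\<in>Obj C. on0 F X \<in> Obj D \<and> on1 F X X (id1 C X) = id1 D (on0 F X)) \<and>
     (\<forall>X\<in>Obj C. \<forall>Y\<in>Obj C.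
        is_cat_functor (Hom C X Y) (Hom D (on0 F X) (on0 F Y)) (on1 F X Y) (on2 F X Y)) \<and>
     (\<forall>X\<in>Obj C. \<forall>Y\<in>Obj C. \<forall>Z\<in>Obj C.
        (\<forall>f\<in>Ob (Hom C X Y). \<forall>g\<in>Ob (Hom C Y Z).
           on1 F X Z (comp1 C X Y Z g f) =
           comp1 D (on0 F X) (on0 F Y) (on0 F Z) (on1 F Y Z g) (on1 F X Y f)) \<and>
        (\<forall>a\<in>Ar (Hom C X Y). \<forall>b\<in>Ar (Hom C Y Z).
           on2 F X Z (comp2 C X Y Z b a) =
           comp2 D (on0 F X) (on0 F Y) (on0 F Z) (on2 F Y Z b) (on2 F X Y a)))"

definition full_sub :: "('o, 'm, 'c) two_cat \<Rightarrow> 'o set \<Rightarrow> ('o, 'm, 'c) two_cat" where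
  "full_sub C S = C\<lparr>Obj := S\<rparr>"

text \<open>\<open>F\<close> is a left adjoint of \<open>G : D \<rightarrow> C\<close> defined on the full sub-2-category of \<open>C\<close> on the
  objects \<open>S\<close>: isomorphisms of categories \<open>Hom (F X) Y \<cong> Hom X (G Y)\<close>, given by \<open>P1\<close> on 1-cells
  and \<open>P2\<close> on 2-cells, for all \<open>X \<in> S\<close> and all \<open>Y\<close>, 2-natural in both variables.\<close>

definition left_adjoint_data_on ::
    "'o set \<Rightarrow> ('o2, 'm2, 'c2) two_cat \<Rightarrow> ('o, 'm, 'c) two_cat
     \<Rightarrow> ('o2, 'm2, 'c2, 'o, 'm, 'c) two_functor \<Rightarrow> ('o, 'm, 'c, 'o2, 'm2, 'c2) two_functor
     \<Rightarrow> ('o \<Rightarrow> 'o2 \<Rightarrow> 'm2 \<Rightarrow> 'm) \<Rightarrow> ('o \<Rightarrow> 'o2 \<Rightarrow> 'c2 \<Rightarrow> 'c) \<Rightarrow> bool" where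
  "left_adjoint_data_on S D C G F P1 P2 \<longleftrightarrow>
     S \<subseteq> Obj C \<and> strict_2_functor D C G \<and> strict_2_functor (full_sub C S) D F \<and>
     (\<forall>X\<in>S. \<forall>Y\<in>Obj D.
        is_cat_iso (Hom D (on0 F X) Y) (Hom C X (on0 G Y)) (P1 X Y) (P2 X Y)) \<and>
     (\<forall>X\<in>S. \<forall>X'\<in>S. \<forall>Y\<in>Obj D. \<forall>Y'\<in>Obj D.
        (\<forall>f\<in>Ob (Hom C X' X). \<forall>g\<in>Ob (Hom D Y Y'). \<forall>h\<in>Ob (Hom D (on0 F X) Y).
           P1 X' Y' (comp1 D (on0 F X') Y Y' g
                      (comp1 D (on0 F X') (on0 F X) Y h (on1 F X' X f))) =
           comp1 C X' (on0 G Y) (on0 G Y') (on1 G Y Y' g)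
             (comp1 C X' X (on0 G Y) (P1 X Y h) f)) \<and>
        (\<forall>a\<in>Ar (Hom C X' X). \<forall>b\<in>Ar (Hom D Y Y'). \<forall>c\<in>Ar (Hom D (on0 F X) Y).
           P2 X' Y' (comp2 D (on0 F X') Y Y' b
                      (comp2 D (on0 F X') (on0 F X) Y c (on2 F X' X a))) =
           comp2 C X' (on0 G Y) (on0 G Y') (on2 G Y Y' b)
             (comp2 C X' X (on0 G Y) (P2 X Y c) a)))"

definition has_left_adjoint_on ::
    "'o set \<Rightarrow> ('o2, 'm2, 'c2) two_cat \<Rightarrow> ('o, 'm, 'c) two_cat
     \<Rightarrow> ('o2, 'm2, 'c2, 'o, 'm, 'c) two_functor \<Rightarrow> bool" where
  "has_left_adjoint_on S D C G \<longleftrightarrow> (\<exists>F P1 P2. left_adjoint_data_on S D C G F P1 P2)"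

definition has_left_adjoint ::
    "('o2, 'm2, 'c2) two_cat \<Rightarrow> ('o, 'm, 'c) two_cat
     \<Rightarrow> ('o2, 'm2, 'c2, 'o, 'm, 'c) two_functor \<Rightarrow> bool" where
  "has_left_adjoint D C G \<longleftrightarrow> has_left_adjoint_on (Obj C) D C G"


section \<open>Topological monoids and powder monoids\<close>

record 'a topmonoid = "'a monoid" +
  topol :: "'a topology"

definition topological_monoid :: "'a topmonoid \<Rightarrow> bool" where
  "topological_monoid M \<longleftrightarrow>
     monoid M \<and> topspace (topol M) = carrier M \<and>
     continuous_map (prod_topology (topol M) (topol M)) (topol M) (\<lambda>(x, y). x \<otimes>\<^bsub>M\<^esub> y)"

definition translate :: "'a topmonoid \<Rightarrow> 'a \<Rightarrow> 'a set \<Rightarrow> 'a set" where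
  \<comment> \<open>\<open>p\<^sup>*(A)\<close>\<close>
  "translate M p A = {m \<in> carrier M. p \<otimes>\<^bsub>M\<^esub> m \<in> A}"

definition translate_class :: "'a topmonoid \<Rightarrow> 'a set \<Rightarrow> 'a \<Rightarrow> 'a set" where
  \<comment> \<open>\<open>\<I>\<close> with subscript \<open>A\<close> and superscript \<open>p\<close>\<close>
  "translate_class M A p = {m \<in> carrier M. translate M m A = translate M p A}"

definition action_base :: "'a topmonoid \<Rightarrow> 'a set set" where
  "action_base M = {A. A \<subseteq> carrier M \<and>
     (\<forall>p\<in>carrier M. \<forall>q\<in>carrier M. openin (topol M) (translate_class M (translate M q A) p))}"

definition has_action_topology :: "'a topmonoid \<Rightarrow> bool" where
  "has_action_topology M \<longleftrightarrow> openin (topol M) = arbitrary union_of (\<lambda>A. A \<in> action_base M)"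

definition powder_monoid :: "'a topmonoid \<Rightarrow> bool" where
  "powder_monoid M \<longleftrightarrow>
     topological_monoid M \<and> t0_space (topol M) \<and> has_action_topology M"


section \<open>Complete monoids\<close>

definition right_congruence :: "'a topmonoid \<Rightarrow> ('a \<times> 'a) set \<Rightarrow> bool" where
  "right_congruence M r \<longleftrightarrow>
     equiv (carrier M) r \<and>
     (\<forall>p q m. (p, q) \<in> r \<and> m \<in> carrier M \<longrightarrow> (p \<otimes>\<^bsub>M\<^esub> m, q \<otimes>\<^bsub>M\<^esub> m) \<in> r)"

definition topological_mset :: "'a topmonoid \<Rightarrow> 'x set \<Rightarrow> ('x \<Rightarrow> 'a \<Rightarrow> 'x) \<Rightarrow> bool" where
  "topological_mset M X act \<longleftrightarrow>
     (\<forall>x\<in>X. \<forall>m\<in>carrier M. act x m \<in> X) \<and>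
     (\<forall>x\<in>X. act x \<one>\<^bsub>M\<^esub> = x) \<and>
     (\<forall>x\<in>X. \<forall>m\<in>carrier M. \<forall>n\<in>carrier M. act (act x m) n = act x (m \<otimes>\<^bsub>M\<^esub> n)) \<and>
     continuous_map (prod_topology (discrete_topology X) (topol M)) (discrete_topology X)
       (\<lambda>(x, m). act x m)"

definition quotient_act :: "'a topmonoid \<Rightarrow> ('a \<times> 'a) set \<Rightarrow> 'a set \<Rightarrow> 'a \<Rightarrow> 'a set" where
  \<comment> \<open>\<open>[a] m = [a m]\<close>\<close>
  "quotient_act M r c m = (\<Union>a\<in>c. r `` {a \<otimes>\<^bsub>M\<^esub> m})"

definition open_congs :: "'a topmonoid \<Rightarrow> ('a \<times> 'a) set set" where
  \<comment> \<open>\<open>\<R>\<close> with subscript \<open>\<tau>\<close>\<close>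
  "open_congs M =
     {r. right_congruence M r \<and> topological_mset M (carrier M // r) (quotient_act M r)}"

definition pull_cong :: "'a topmonoid \<Rightarrow> 'a \<Rightarrow> ('a \<times> 'a) set \<Rightarrow> ('a \<times> 'a) set" where
  \<comment> \<open>\<open>m\<^sup>*(r)\<close>\<close>
  "pull_cong M m r =
     {(x, y). x \<in> carrier M \<and> y \<in> carrier M \<and> (m \<otimes>\<^bsub>M\<^esub> x, m \<otimes>\<^bsub>M\<^esub> y) \<in> r}"

definition to_limit :: "'a topmonoid \<Rightarrow> 'a \<Rightarrow> ('a \<times> 'a) set \<Rightarrow> 'a set" where
  \<comment> \<open>\<open>u\<close>\<close>
  "to_limit M m = (\<lambda>r\<in>open_congs M. r `` {m})"

definition limit_carrier :: "'a topmonoid \<Rightarrow> (('a \<times> 'a) set \<Rightarrow> 'a set) set" where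
  \<comment> \<open>for \<open>r \<subseteq> s\<close> the transition map \<open>M/r \<rightarrow> M/s\<close> is \<open>c \<mapsto> s `` c\<close>\<close>
  "limit_carrier M =
     {x \<in> (\<Pi>\<^sub>E r\<in>open_congs M. carrier M // r).
        \<forall>r\<in>open_congs M. \<forall>s\<in>open_congs M. r \<subseteq> s \<longrightarrow> x s = s `` x r}"

text \<open>The unions in the product range over the representatives of the classes involved; the
  value does not depend on the representatives, so each union is a single class.\<close>

definition completion :: "'a topmonoid \<Rightarrow> (('a \<times> 'a) set \<Rightarrow> 'a set) topmonoid" where
  "completion M =
     \<lparr>carrier = limit_carrier M,
      mult = (\<lambda>x y. \<lambda>r\<in>open_congs M.
                \<Union>a\<in>x r. \<Union>b\<in>y (pull_cong M a r). r `` {a \<otimes>\<^bsub>M\<^esub> b}),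
      one = to_limit M \<one>\<^bsub>M\<^esub>,
      topol = topology_generated_by
                {{x \<in> limit_carrier M. x r \<in> S} | r S. r \<in> open_congs M \<and> S \<subseteq> carrier M // r}\<rparr>"

definition complete_monoid :: "'a topmonoid \<Rightarrow> bool" where
  "complete_monoid M \<longleftrightarrow>
     topological_monoid M \<and>
     to_limit M \<in> iso M (completion M) \<and> to_limit M \<one>\<^bsub>M\<^esub> = \<one>\<^bsub>completion M\<^esub> \<and>
     homeomorphic_map (topol M) (topol (completion M)) (to_limit M)"


section \<open>The 2-categories of powder monoids and of complete monoids\<close>

text \<open>\<open>hom M N\<close> of \<^theory>\<open>HOL-Algebra.Group\<close> does not ask for preservation of the unit.
  Homomorphisms are extensional, so that equality of 1-cells is equality on the carrier.\<close>

definition cont_hom :: "'a topmonoid \<Rightarrow> 'a topmonoid \<Rightarrow> ('a \<Rightarrow> 'a) set" where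
  "cont_hom M N =
     {f \<in> hom M N. f \<in> extensional (carrier M) \<and> continuous_map (topol M) (topol N) f}"

definition conjugation ::
    "'a topmonoid \<Rightarrow> 'a topmonoid \<Rightarrow> ('a \<Rightarrow> 'a) \<Rightarrow> 'a \<Rightarrow> ('a \<Rightarrow> 'a) \<Rightarrow> bool" where
  "conjugation M N f a g \<longleftrightarrow>
     a \<in> carrier N \<and> a \<otimes>\<^bsub>N\<^esub> f \<one>\<^bsub>M\<^esub> = a \<and> g \<one>\<^bsub>M\<^esub> \<otimes>\<^bsub>N\<^esub> a = a \<and>
     (\<forall>m\<in>carrier M. a \<otimes>\<^bsub>N\<^esub> f m = g m \<otimes>\<^bsub>N\<^esub> a)"

type_synonym 'a conj_cell = "('a \<Rightarrow> 'a) \<times> 'a \<times> ('a \<Rightarrow> 'a)"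

definition smon_hom_cat ::
    "'a topmonoid \<Rightarrow> 'a topmonoid \<Rightarrow> ('a \<Rightarrow> 'a, 'a conj_cell) cat" where
  "smon_hom_cat M N =
     \<lparr>Ob = cont_hom M N,
      Ar = {(f, a, g). f \<in> cont_hom M N \<and> g \<in> cont_hom M N \<and> conjugation M N f a g},
      src = (\<lambda>(f, a, g). f),
      tgt = (\<lambda>(f, a, g). g),
      ide = (\<lambda>f. (f, f \<one>\<^bsub>M\<^esub>, f)),
      cmp = (\<lambda>(g, b, h) (f, a, g'). (f, b \<otimes>\<^bsub>N\<^esub> a, h))\<rparr>"

definition smon_two_cat ::
    "'a topmonoid set \<Rightarrow> ('a topmonoid, 'a \<Rightarrow> 'a, 'a conj_cell) two_cat" where
  "smon_two_cat \<O> =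
     \<lparr>Obj = \<O>,
      Hom = smon_hom_cat,
      id1 = (\<lambda>M. \<lambda>x\<in>carrier M. x),
      comp1 = (\<lambda>L M N. compose (carrier L)),
      comp2 = (\<lambda>L M N (f', a', g') (f, a, g).
                 (compose (carrier L) f' f, a' \<otimes>\<^bsub>N\<^esub> f' a, compose (carrier L) g' g))\<rparr>"

text \<open>Size: the objects are the monoids whose carrier belongs to a family \<open>U\<close> of sets, which
  plays the part of the collection of small sets.\<close>

definition PMon :: "'u set set \<Rightarrow> ('u topmonoid, 'u \<Rightarrow> 'u, 'u conj_cell) two_cat" where
  "PMon U = smon_two_cat {M. carrier M \<in> U \<and> powder_monoid M}"

definition CMon :: "'u set set \<Rightarrow> ('u topmonoid, 'u \<Rightarrow> 'u, 'u conj_cell) two_cat" where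
  "CMon U = smon_two_cat {M. carrier M \<in> U \<and> complete_monoid M}"

definition inclusion :: "('o, 'm, 'c, 'o, 'm, 'c) two_functor" where
  "inclusion = \<lparr>on0 = (\<lambda>X. X), on1 = (\<lambda>X Y f. f), on2 = (\<lambda>X Y a. a)\<rparr>"

definition universe :: "'u set set \<Rightarrow> bool" where
  "universe U \<longleftrightarrow>
     (\<forall>A\<in>U. \<forall>B. B \<lesssim> A \<longrightarrow> B \<in> U) \<and>
     (\<forall>A\<in>U. \<exists>B\<in>U. Pow A \<lesssim> B)"

text \<open>HOL does not prove that there is a universe with an infinite member. Enlargements replace
  universes there: \<open>U\<close>-small monoids may have their completion among the \<open>V\<close>-small ones.
  Every universe is an enlargement of itself, and the lemma below gives, over every type,
  an enlargement for the monoids of at most the cardinality of that type. Completions do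
  raise cardinality, so some such enlargement is needed.\<close>

definition enlargement :: "'u set set \<Rightarrow> 'u set set \<Rightarrow> bool" where
  "enlargement U V \<longleftrightarrow>
     U \<subseteq> V \<and>
     (\<forall>A\<in>V. \<forall>B. B \<lesssim> A \<longrightarrow> B \<in> V) \<and>
     (\<forall>A\<in>U. \<exists>B\<in>V. Pow (Pow A) \<lesssim> B)"

lemma lepoll_Pow: "A \<lesssim> B \<Longrightarrow> Pow A \<lesssim> Pow B"
  unfolding lepoll_def by (metis image_Pow_mono inj_on_image_Pow)

lemma enlargement_self: "universe U \<Longrightarrow> enlargement U U"
  unfolding universe_def enlargement_def by (meson lepoll_Pow lepoll_trans subset_refl)

lemma enlargement_double_Pow:
  "enlargement {A :: 'a set set set. A \<lesssim> (UNIV :: 'a set)} UNIV"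
proof -
  have "Pow (Pow A) \<lesssim> (UNIV :: 'a set set set)" if "A \<lesssim> (UNIV :: 'a set)" for A :: "'a set set set"
    using lepoll_Pow[OF lepoll_Pow[OF that]] by simp
  then show ?thesis
    unfolding enlargement_def by auto
qed

end

(* Right congruences of M with open classes pull back along left translations, so the classes of an
   element of the limit L multiply, and the open right congruences of L are exactly the relations
   "equal r-th component" with r ranging over those of M; hence L is complete. The image of M is dense
   in L, and a complete monoid is Hausdorff, so continuous maps out of L into a complete monoid are
   determined by their restriction to M; this also identifies the conjugations between homomorphisms
   on L with those between their restrictions. A continuous semigroup homomorphism f : M \<rightarrow> Y into a
   complete monoid extends to L: an open right congruence s of Y pulls back along f to one of M, and
   the f-image of the corresponding component of x \<in> L lies in a single class of s; completeness of Y
   provides the point with these classes. So M \<rightarrow> L is a 2-dimensional universal arrow. *)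
theory Submission
  imports Defs
begin

section \<open>Open right congruences\<close>

text \<open>The limit \<open>L\<close> is one of right \<open>M\<close>-sets, not of monoids: the
  component of a product \<open>x y\<close> at \<open>r\<close> reads \<open>y\<close> at the
  shifted index \<open>a^*(r)\<close>, where \<open>a\<close> represents \<open>x\<close> at
  \<open>r\<close>. Hence open congruences must be stable under these shifts as well as under
  intersection, and calculations use representatives chosen at successively shifted indices. Two
  further obstacles shape the proof. Size: elements of \<open>L\<close> are functions on
  congruences, while all objects of the 2-categories share one carrier type and a size bound. So
  \<open>L\<close> is embedded into the double power set of the carrier, from there into a set
  supplied by the enlargement, and the argument is carried out for any monoid isomorphic to
  \<open>L\<close>. Units: homomorphisms may move the identity, so identity 2-cells are the
  idempotents \<open>f(1)\<close>. The arrow \<open>M -> L\<close> does preserve the identity, which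
  lets the two conditions at \<open>1\<close> in a conjugation pass between \<open>M\<close> and
  \<open>L\<close>. Since the element of a 2-cell lies in the target, which is the same on both
  sides, the hom-isomorphism leaves it unchanged.\<close>

lemma quotient_act_class:
  assumes "right_congruence M r" "monoid M" "a \<in> carrier M" "m \<in> carrier M"
  shows "quotient_act M r (r `` {a}) m = r `` {a \<otimes>\<^bsub>M\<^esub> m}"
proof -
  have e: "equiv (carrier M) r"
    and c: "\<And>p q m. (p, q) \<in> r \<Longrightarrow> m \<in> carrier M \<Longrightarrow> (p \<otimes>\<^bsub>M\<^esub> m, q \<otimes>\<^bsub>M\<^esub> m) \<in> r"
    using assms(1) unfolding right_congruence_def by auto
  have "r `` {b \<otimes>\<^bsub>M\<^esub> m} = r `` {a \<otimes>\<^bsub>M\<^esub> m}" if "b \<in> r `` {a}" for b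
    using equiv_class_eq[OF e] c[of a b m] that assms(4) by auto
  moreover have "a \<in> r `` {a}"
    using equiv_class_self[OF e assms(3)] .
  ultimately show ?thesis
    unfolding quotient_act_def by blast
qed

lemma topological_monoidD:
  assumes "topological_monoid M"
  shows "monoid M" "topspace (topol M) = carrier M"
    "continuous_map (prod_topology (topol M) (topol M)) (topol M) (\<lambda>(x, y). x \<otimes>\<^bsub>M\<^esub> y)"
  using assms unfolding topological_monoid_def by auto

lemma continuous_map_mult:
  assumes M: "topological_monoid M"
    and f: "continuous_map X (topol M) f" and g: "continuous_map X (topol M) g"
  shows "continuous_map X (topol M) (\<lambda>x. f x \<otimes>\<^bsub>M\<^esub> g x)"
proof -
  have "continuous_map X (prod_topology (topol M) (topol M)) (\<lambda>x. (f x, g x))"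
    using f g by (simp add: continuous_map_pairedI)
  from continuous_map_compose[OF this topological_monoidD(3)[OF M]]
  show ?thesis by (simp add: o_def)
qed

lemma continuous_map_mult_left:
  assumes M: "topological_monoid M" and a: "a \<in> carrier M"
    and g: "continuous_map X (topol M) g"
  shows "continuous_map X (topol M) (\<lambda>x. a \<otimes>\<^bsub>M\<^esub> g x)"
  using topological_monoidD(2)[OF M] a by (intro continuous_map_mult[OF M _ g]) simp

lemma continuous_map_mult_right:
  assumes M: "topological_monoid M" and a: "a \<in> carrier M"
    and g: "continuous_map X (topol M) g"
  shows "continuous_map X (topol M) (\<lambda>x. g x \<otimes>\<^bsub>M\<^esub> a)"
  using topological_monoidD(2)[OF M] a by (intro continuous_map_mult[OF M g]) simp

text \<open>In one direction, the class of \<open>x\<close> is the preimage of a point under the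
  orbit map \<open>m \<mapsto> [1] m\<close>, which is continuous. In the other, continuity at
  \<open>([a], m)\<close> only needs a neighbourhood of \<open>m\<close>, since \<open>M/r\<close>
  is discrete: the \<open>n\<close> with \<open>a n\<close> in the class of \<open>a m\<close> form
  an open set because left multiplication by \<open>a\<close> is continuous. From here on the action
  enters only through open classes.\<close>

lemma open_congs_iff:
  assumes M: "topological_monoid M"
  shows "r \<in> open_congs M \<longleftrightarrow>
    right_congruence M r \<and> (\<forall>x\<in>carrier M. openin (topol M) (r `` {x}))"
proof (cases "right_congruence M r")
  case rc: True
  interpret monoid M using topological_monoidD(1)[OF M] .
  note ts = topological_monoidD(2)[OF M]
  have e: "equiv (carrier M) r" using rc unfolding right_congruence_def by auto
  note act = quotient_act_class[OF rc monoid_axioms]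
  let ?X = "carrier M // r" and ?act = "quotient_act M r"
  have cl: "\<exists>a\<in>carrier M. c = r `` {a}" if "c \<in> ?X" for c
    using that by (auto elim: quotientE)
  have alg: "(\<forall>x\<in>?X. \<forall>m\<in>carrier M. ?act x m \<in> ?X) \<and> (\<forall>x\<in>?X. ?act x \<one>\<^bsub>M\<^esub> = x) \<and>
     (\<forall>x\<in>?X. \<forall>m\<in>carrier M. \<forall>n\<in>carrier M. ?act (?act x m) n = ?act x (m \<otimes>\<^bsub>M\<^esub> n))"
    by (intro conjI ballI; drule cl; clarsimp simp: act m_assoc quotientI)
  show ?thesis
  proof
    assume "r \<in> open_congs M"
    then have cont: "continuous_map (prod_topology (discrete_topology ?X) (topol M))
        (discrete_topology ?X) (\<lambda>(x, m). ?act x m)"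
      unfolding open_congs_def topological_mset_def by blast
    have "continuous_map (topol M) (prod_topology (discrete_topology ?X) (topol M)) (\<lambda>m. (r `` {\<one>\<^bsub>M\<^esub>}, m))"
      by (simp add: continuous_map_pairedI quotientI)
    from continuous_map_compose[OF this cont]
    have c: "continuous_map (topol M) (discrete_topology ?X) (\<lambda>m. ?act (r `` {\<one>\<^bsub>M\<^esub>}) m)"
      by (simp add: o_def)
    have "openin (topol M) (r `` {x})" if x: "x \<in> carrier M" for x
    proof -
      have "openin (topol M) {m \<in> topspace (topol M). ?act (r `` {\<one>\<^bsub>M\<^esub>}) m \<in> {r `` {x}}}"
        by (rule openin_continuous_map_preimage[OF c]) (simp add: x quotientI)
      also have "{m \<in> topspace (topol M). ?act (r `` {\<one>\<^bsub>M\<^esub>}) m \<in> {r `` {x}}} = r `` {x}"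
      proof -
        have "?act (r `` {\<one>\<^bsub>M\<^esub>}) m = r `` {x} \<longleftrightarrow> m \<in> r `` {x}" if "m \<in> carrier M" for m
          using eq_equiv_class_iff[OF e x that] by (auto simp: act that)
        moreover have "r `` {x} \<subseteq> carrier M"
          using equiv_type[OF e] by blast
        ultimately show ?thesis by (auto simp: ts)
      qed
      finally show ?thesis .
    qed
    with rc show "right_congruence M r \<and> (\<forall>x\<in>carrier M. openin (topol M) (r `` {x}))" by blast
  next
    assume "right_congruence M r \<and> (\<forall>x\<in>carrier M. openin (topol M) (r `` {x}))"
    then have op: "openin (topol M) (r `` {x})" if "x \<in> carrier M" for x using that by blast
    have "continuous_map (prod_topology (discrete_topology ?X) (topol M))
        (discrete_topology ?X) (\<lambda>(x, m). ?act x m)"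
      unfolding continuous_map_def
    proof (intro conjI allI impI)
      show "(\<lambda>(x, m). ?act x m) \<in> topspace (prod_topology (discrete_topology ?X) (topol M))
          \<rightarrow> topspace (discrete_topology ?X)"
        using alg by (auto simp: ts)
    next
      fix D assume "openin (discrete_topology ?X) D"
      show "openin (prod_topology (discrete_topology ?X) (topol M))
          {z \<in> topspace (prod_topology (discrete_topology ?X) (topol M)). (case z of (x, m) \<Rightarrow> ?act x m) \<in> D}"
        unfolding openin_prod_topology_alt
      proof (intro allI impI)
        fix c m
        assume "(c, m) \<in> {z \<in> topspace (prod_topology (discrete_topology ?X) (topol M)). (case z of (x, m) \<Rightarrow> ?act x m) \<in> D}"
        then have c: "c \<in> ?X" "m \<in> carrier M" "?act c m \<in> D" by (auto simp: ts)
        obtain a where a: "a \<in> carrier M" "c = r `` {a}" using cl[OF c(1)] by blast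
        let ?V = "{n \<in> topspace (topol M). a \<otimes>\<^bsub>M\<^esub> n \<in> r `` {a \<otimes>\<^bsub>M\<^esub> m}}"
        have "continuous_map (topol M) (topol M) (\<lambda>n. a \<otimes>\<^bsub>M\<^esub> n)"
          by (rule continuous_map_mult_left[OF M a(1)]) simp
        then have "openin (topol M) ?V"
          by (rule openin_continuous_map_preimage) (simp add: op a c)
        moreover have "m \<in> ?V" using equiv_class_self[OF e] a c by (simp add: ts)
        moreover have "{c} \<times> ?V \<subseteq> {z \<in> topspace (prod_topology (discrete_topology ?X) (topol M)). (case z of (x, m) \<Rightarrow> ?act x m) \<in> D}"
        proof -
          have "?act c n \<in> D" if "n \<in> ?V" for n
          proof -
            have "r `` {a \<otimes>\<^bsub>M\<^esub> m} = r `` {a \<otimes>\<^bsub>M\<^esub> n}" using that equiv_class_eq[OF e] by blast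
            with c a that show ?thesis by (simp add: act ts)
          qed
          with c show ?thesis by (auto simp: ts)
        qed
        moreover have "openin (discrete_topology ?X) {c}" using c(1) by simp
        ultimately show "\<exists>U V. openin (discrete_topology ?X) U \<and> openin (topol M) V \<and> c \<in> U \<and> m \<in> V \<and>
          U \<times> V \<subseteq> {z \<in> topspace (prod_topology (discrete_topology ?X) (topol M)). (case z of (x, m) \<Rightarrow> ?act x m) \<in> D}"
          by (meson singletonI)
      qed
    qed
    with alg have "topological_mset M ?X ?act"
      unfolding topological_mset_def by simp
    with rc show "r \<in> open_congs M"
      unfolding open_congs_def by simp
  qed
qed (auto simp: open_congs_def)

context
  fixes M :: "'a topmonoid"
  assumes M: "topological_monoid M"
begin

interpretation monoid M using topological_monoidD(1)[OF M] .

lemma open_congs_equiv: "r \<in> open_congs M \<Longrightarrow> equiv (carrier M) r"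
  unfolding open_congs_def right_congruence_def by auto

lemma open_congs_mult:
  "r \<in> open_congs M \<Longrightarrow> (p, q) \<in> r \<Longrightarrow> m \<in> carrier M \<Longrightarrow> (p \<otimes>\<^bsub>M\<^esub> m, q \<otimes>\<^bsub>M\<^esub> m) \<in> r"
  unfolding open_congs_def right_congruence_def by auto

lemma open_congs_openin: "r \<in> open_congs M \<Longrightarrow> x \<in> carrier M \<Longrightarrow> openin (topol M) (r `` {x})"
  using open_congs_iff[OF M] by blast

lemma open_congs_memD: "r \<in> open_congs M \<Longrightarrow> (x, y) \<in> r \<Longrightarrow> x \<in> carrier M \<and> y \<in> carrier M"
  using equiv_type[OF open_congs_equiv] by blast

lemma open_congs_refl: "r \<in> open_congs M \<Longrightarrow> x \<in> carrier M \<Longrightarrow> (x, x) \<in> r"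
  using open_congs_equiv by (meson equivE refl_onD)

lemma open_congs_sym: "r \<in> open_congs M \<Longrightarrow> (x, y) \<in> r \<Longrightarrow> (y, x) \<in> r"
  using open_congs_equiv by (meson equivE symD)

lemma open_congs_trans: "r \<in> open_congs M \<Longrightarrow> (x, y) \<in> r \<Longrightarrow> (y, z) \<in> r \<Longrightarrow> (x, z) \<in> r"
  using open_congs_equiv by (meson equivE transD)

lemma open_congs_class_eq_iff:
  "r \<in> open_congs M \<Longrightarrow> x \<in> carrier M \<Longrightarrow> y \<in> carrier M \<Longrightarrow> r `` {x} = r `` {y} \<longleftrightarrow> (x, y) \<in> r"
  using eq_equiv_class_iff[OF open_congs_equiv] .

text \<open>The index at which a component carries no information: it shows the whole limit to be
  open, and it turns statements about a prescribed class into plain density.\<close>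

lemma open_congs_UNIV: "carrier M \<times> carrier M \<in> open_congs M"
proof -
  have "(carrier M \<times> carrier M) `` {x} = topspace (topol M)" if "x \<in> carrier M" for x
    using that topological_monoidD(2)[OF M] by auto
  moreover have "right_congruence M (carrier M \<times> carrier M)"
    unfolding right_congruence_def by (auto simp: equiv_def refl_on_def sym_def trans_def)
  ultimately show ?thesis
    by (simp add: open_congs_iff[OF M])
qed

text \<open>Directs the index set: fixing the component at \<open>r \<inter> s\<close> fixes those
  at \<open>r\<close> and at \<open>s\<close>, so finitely many conditions on an element of the
  limit reduce to one.\<close>

lemma open_congs_Int:
  assumes "r \<in> open_congs M" "s \<in> open_congs M"
  shows "r \<inter> s \<in> open_congs M"
proof -
  have "(r \<inter> s) `` {x} = r `` {x} \<inter> s `` {x}" for x by auto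
  moreover have "equiv (carrier M) (r \<inter> s)"
    using assms[THEN open_congs_equiv]
    by (auto simp: equiv_def refl_on_def sym_def intro: trans_Int)
  ultimately show ?thesis
    using assms by (auto simp: open_congs_iff[OF M] right_congruence_def)
qed

end

section \<open>Inverse images of open congruences and shifts of the index\<close>

text \<open>The compatibility hypothesis is weaker than multiplicativity of \<open>f\<close>.
  Besides homomorphisms it thus covers left translations, which in general are not homomorphisms but
  commute with right multiplication.\<close>

lemma open_congs_vimage:
  assumes M: "topological_monoid M" and N: "topological_monoid N"
    and f: "continuous_map (topol M) (topol N) f"
    and mult: "\<And>p q m. p \<in> carrier M \<Longrightarrow> q \<in> carrier M \<Longrightarrow> m \<in> carrier M \<Longrightarrow>
      (f p, f q) \<in> s \<Longrightarrow> (f (p \<otimes>\<^bsub>M\<^esub> m), f (q \<otimes>\<^bsub>M\<^esub> m)) \<in> s"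
    and s: "s \<in> open_congs N"
  shows "{(x, y). x \<in> carrier M \<and> y \<in> carrier M \<and> (f x, f y) \<in> s} \<in> open_congs M" (is "?r \<in> _")
proof -
  interpret monoid M using topological_monoidD(1)[OF M] .
  have fc: "f x \<in> carrier N" if "x \<in> carrier M" for x
    using continuous_map_image_subset_topspace[OF f] topological_monoidD(2)[OF M]
      topological_monoidD(2)[OF N] that by auto
  have "equiv (carrier M) ?r"
  proof (rule equivI)
    show "refl_on (carrier M) ?r"
      using fc open_congs_refl[OF N s] by (auto simp: refl_on_def)
    show "sym ?r"
      using open_congs_sym[OF N s] by (blast intro: symI)
    show "trans ?r"
      using open_congs_trans[OF N s] by (blast intro: transI)
  qed blast
  moreover have "openin (topol M) (?r `` {x})" if x: "x \<in> carrier M" for x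
  proof -
    have "?r `` {x} = {y \<in> topspace (topol M). f y \<in> s `` {f x}}"
      using x topological_monoidD(2)[OF M] by auto
    then show ?thesis
      using openin_continuous_map_preimage[OF f open_congs_openin[OF N s fc[OF x]]] by simp
  qed
  ultimately show ?thesis
    unfolding open_congs_iff[OF M] right_congruence_def using mult by auto
qed

lemma pull_cong_open_congs:
  assumes M: "topological_monoid M" and r: "r \<in> open_congs M" and a: "a \<in> carrier M"
  shows "pull_cong M a r \<in> open_congs M"
proof -
  interpret monoid M using topological_monoidD(1)[OF M] .
  have "continuous_map (topol M) (topol M) (\<lambda>x. a \<otimes>\<^bsub>M\<^esub> x)"
    by (rule continuous_map_mult_left[OF M a]) simp
  moreover have "(a \<otimes>\<^bsub>M\<^esub> (p \<otimes>\<^bsub>M\<^esub> m), a \<otimes>\<^bsub>M\<^esub> (q \<otimes>\<^bsub>M\<^esub> m)) \<in> r"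
    if "p \<in> carrier M" "q \<in> carrier M" "m \<in> carrier M" "(a \<otimes>\<^bsub>M\<^esub> p, a \<otimes>\<^bsub>M\<^esub> q) \<in> r" for p q m
    using open_congs_mult[OF M r that(4,3)] that a by (simp add: m_assoc)
  ultimately show ?thesis
    unfolding pull_cong_def
    by (rule open_congs_vimage[OF M M _ _ r, where f = "\<lambda>x. a \<otimes>\<^bsub>M\<^esub> x"])
qed

text \<open>Right compatibility turns \<open>(a, b) \<in> r\<close> into
  \<open>(a x, b x) \<in> r\<close> for every \<open>x\<close>. So the index at which a product
  reads its second factor depends only on the class of \<open>a\<close>.\<close>

lemma pull_cong_cong:
  assumes M: "topological_monoid M" and r: "r \<in> open_congs M" and ab: "(a, b) \<in> r"
  shows "pull_cong M a r = pull_cong M b r"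
proof -
  have "(a \<otimes>\<^bsub>M\<^esub> x, a \<otimes>\<^bsub>M\<^esub> y) \<in> r \<longleftrightarrow> (b \<otimes>\<^bsub>M\<^esub> x, b \<otimes>\<^bsub>M\<^esub> y) \<in> r"
    if "x \<in> carrier M" "y \<in> carrier M" for x y
    using open_congs_mult[OF M r ab that(1)] open_congs_mult[OF M r ab that(2)]
    by (meson open_congs_sym[OF M r] open_congs_trans[OF M r])
  then show ?thesis
    unfolding pull_cong_def by blast
qed

text \<open>The identity behind associativity in the limit: the index reached through
  \<open>a b\<close> is the one reached through \<open>a\<close> and then through
  \<open>b\<close>.\<close>

lemma pull_cong_mult:
  assumes "monoid M" and "a \<in> carrier M" "b \<in> carrier M"
  shows "pull_cong M (a \<otimes>\<^bsub>M\<^esub> b) r = pull_cong M b (pull_cong M a r)"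
  using assms by (auto simp: pull_cong_def monoid.m_assoc monoid.m_closed)

section \<open>The completion\<close>

lemma limit_carrierI:
  assumes "x \<in> extensional (open_congs M)"
    and "\<And>r. r \<in> open_congs M \<Longrightarrow> x r \<in> carrier M // r"
    and "\<And>r s. r \<in> open_congs M \<Longrightarrow> s \<in> open_congs M \<Longrightarrow> r \<subseteq> s \<Longrightarrow> x s = s `` x r"
  shows "x \<in> limit_carrier M"
  unfolding limit_carrier_def
  by (intro CollectI conjI ballI impI PiE_I assms extensional_arb[OF assms(1)])

lemma limit_carrier_ext:
  "x \<in> limit_carrier M \<Longrightarrow> y \<in> limit_carrier M \<Longrightarrow> (\<And>r. r \<in> open_congs M \<Longrightarrow> x r = y r) \<Longrightarrow> x = y"
  unfolding limit_carrier_def by (elim CollectE conjE) (rule PiE_ext)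

lemma limit_carrier_mono:
  "x \<in> limit_carrier M \<Longrightarrow> r \<in> open_congs M \<Longrightarrow> s \<in> open_congs M \<Longrightarrow> r \<subseteq> s \<Longrightarrow> x s = s `` x r"
  unfolding limit_carrier_def by blast

lemma limit_carrier_in_quotient:
  "x \<in> limit_carrier M \<Longrightarrow> r \<in> open_congs M \<Longrightarrow> x r \<in> carrier M // r"
  unfolding limit_carrier_def by (blast dest: PiE_mem)

lemma to_limit_apply: "r \<in> open_congs M \<Longrightarrow> to_limit M m r = r `` {m}"
  by (simp add: to_limit_def)

lemma completion_simps:
  "carrier (completion M) = limit_carrier M" "\<one>\<^bsub>completion M\<^esub> = to_limit M \<one>\<^bsub>M\<^esub>"
  by (simp_all add: completion_def)

context
  fixes M :: "'a topmonoid"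
  assumes M: "topological_monoid M"
begin

interpretation monoid M using topological_monoidD(1)[OF M] .

lemma limit_carrier_classE:
  assumes "x \<in> limit_carrier M" "r \<in> open_congs M"
  obtains a where "a \<in> carrier M" "x r = r `` {a}" "a \<in> x r"
proof -
  obtain a where "a \<in> carrier M" "x r = r `` {a}"
    using limit_carrier_in_quotient[OF assms] by (rule quotientE)
  with that open_congs_refl[OF M assms(2)] show thesis by blast
qed

lemma limit_carrier_class_eq:
  assumes "x \<in> limit_carrier M" "r \<in> open_congs M" "a \<in> x r"
  shows "a \<in> carrier M \<and> x r = r `` {a}"
proof -
  obtain b where b: "b \<in> carrier M" "x r = r `` {b}"
    by (rule limit_carrier_classE[OF assms(1,2)])
  then have "(b, a) \<in> r" using assms by blast
  then show ?thesis
    using b open_congs_class_eq_iff[OF M assms(2)] open_congs_memD[OF M assms(2)] by blast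
qed

lemma to_limit_in_limit_carrier: "m \<in> carrier M \<Longrightarrow> to_limit M m \<in> limit_carrier M"
proof (rule limit_carrierI)
  fix r s assume m: "m \<in> carrier M" and rs: "r \<in> open_congs M" "s \<in> open_congs M" "r \<subseteq> s"
  have "s `` {m} = s `` (r `` {m})"
    using open_congs_refl[OF M rs(1) m] open_congs_trans[OF M rs(2)] rs(3) by blast
  then show "to_limit M m s = s `` to_limit M m r"
    using rs by (simp add: to_limit_apply)
qed (auto simp: to_limit_def quotientI)

text \<open>Independence of the representatives: if \<open>a'\<close> replaces \<open>a\<close>, the
  shifted index is unchanged by \<open>pull_cong_cong\<close>; then \<open>b\<close> and
  \<open>b'\<close> are congruent at that index, which says that \<open>a b\<close> and
  \<open>a b'\<close> are related by \<open>r\<close>, and right compatibility relates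
  \<open>a b'\<close> to \<open>a' b'\<close>.\<close>

lemma completion_mult_apply:
  assumes x: "x \<in> limit_carrier M" and y: "y \<in> limit_carrier M" and r: "r \<in> open_congs M"
    and a: "a \<in> x r" and b: "b \<in> y (pull_cong M a r)"
  shows "(x \<otimes>\<^bsub>completion M\<^esub> y) r = r `` {a \<otimes>\<^bsub>M\<^esub> b}"
proof -
  have ac: "a \<in> carrier M" "x r = r `` {a}"
    using limit_carrier_class_eq[OF x r a] by auto
  let ?s = "pull_cong M a r"
  have s: "?s \<in> open_congs M" by (rule pull_cong_open_congs[OF M r ac(1)])
  have bc: "b \<in> carrier M" "y ?s = ?s `` {b}"
    using limit_carrier_class_eq[OF y s b] by auto
  have "r `` {a' \<otimes>\<^bsub>M\<^esub> b'} = r `` {a \<otimes>\<^bsub>M\<^esub> b}"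
    if a': "a' \<in> x r" and b': "b' \<in> y (pull_cong M a' r)" for a' b'
  proof -
    have 1: "(a, a') \<in> r" using a' ac by blast
    then have 2: "(b, b') \<in> ?s" using b' bc pull_cong_cong[OF M r 1] by auto
    then have "(a \<otimes>\<^bsub>M\<^esub> b, a \<otimes>\<^bsub>M\<^esub> b') \<in> r" "b' \<in> carrier M"
      unfolding pull_cong_def by auto
    then have "(a \<otimes>\<^bsub>M\<^esub> b, a' \<otimes>\<^bsub>M\<^esub> b') \<in> r"
      using open_congs_mult[OF M r 1] open_congs_trans[OF M r] by blast
    then show ?thesis
      using equiv_class_eq[OF open_congs_equiv[OF M r]] by blast
  qed
  then have "(\<Union>a\<in>x r. \<Union>b\<in>y (pull_cong M a r). r `` {a \<otimes>\<^bsub>M\<^esub> b}) = r `` {a \<otimes>\<^bsub>M\<^esub> b}"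
    using a b by blast
  then show ?thesis
    using r by (simp add: completion_def)
qed

lemma completion_mult_apply':
  assumes x: "x \<in> limit_carrier M" and y: "y \<in> limit_carrier M" and r: "r \<in> open_congs M"
    and a: "a \<in> carrier M" "x r = r `` {a}"
    and b: "b \<in> carrier M" "y (pull_cong M a r) = pull_cong M a r `` {b}"
  shows "(x \<otimes>\<^bsub>completion M\<^esub> y) r = r `` {a \<otimes>\<^bsub>M\<^esub> b}"
  using assms open_congs_refl[OF M r a(1)] open_congs_refl[OF M pull_cong_open_congs[OF M r a(1)] b(1)]
  by (intro completion_mult_apply[OF x y r]) auto

text \<open>Representatives chosen for the finer congruence serve the coarser one too, because
  \<open>r \<subseteq> s\<close> is inherited by the shifted indices.\<close>

lemma completion_mult_closed:
  assumes x: "x \<in> limit_carrier M" and y: "y \<in> limit_carrier M"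
  shows "x \<otimes>\<^bsub>completion M\<^esub> y \<in> limit_carrier M"
proof (rule limit_carrierI)
  show "x \<otimes>\<^bsub>completion M\<^esub> y \<in> extensional (open_congs M)"
    by (simp add: completion_def)
next
  fix r assume r: "r \<in> open_congs M"
  obtain a where a: "a \<in> carrier M" "x r = r `` {a}" "a \<in> x r"
    by (rule limit_carrier_classE[OF x r])
  obtain b where b: "b \<in> carrier M" "b \<in> y (pull_cong M a r)"
    by (rule limit_carrier_classE[OF y pull_cong_open_congs[OF M r a(1)]])
  show "(x \<otimes>\<^bsub>completion M\<^esub> y) r \<in> carrier M // r"
    by (simp add: completion_mult_apply[OF x y r a(3) b(2)] quotientI a b)
next
  fix r s assume r: "r \<in> open_congs M" and s: "s \<in> open_congs M" and rs: "r \<subseteq> s"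
  obtain a where a: "a \<in> carrier M" "x r = r `` {a}" "a \<in> x r"
    by (rule limit_carrier_classE[OF x r])
  let ?r = "pull_cong M a r" and ?s = "pull_cong M a s"
  have pr: "?r \<in> open_congs M" and ps: "?s \<in> open_congs M"
    by (auto intro: pull_cong_open_congs[OF M _ a(1)] r s)
  have prs: "?r \<subseteq> ?s" unfolding pull_cong_def using rs by blast
  obtain b where b: "b \<in> carrier M" "b \<in> y ?r"
    by (rule limit_carrier_classE[OF y pr])
  have "a \<in> x s" using limit_carrier_mono[OF x r s rs] a open_congs_refl[OF M s] by blast
  moreover have "b \<in> y ?s"
    using limit_carrier_mono[OF y pr ps prs] b open_congs_refl[OF M ps] by blast
  ultimately have "(x \<otimes>\<^bsub>completion M\<^esub> y) s = s `` {a \<otimes>\<^bsub>M\<^esub> b}"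
    by (rule completion_mult_apply[OF x y s])
  moreover have "(x \<otimes>\<^bsub>completion M\<^esub> y) r = r `` {a \<otimes>\<^bsub>M\<^esub> b}"
    by (rule completion_mult_apply[OF x y r a(3) b(2)])
  moreover have "s `` {a \<otimes>\<^bsub>M\<^esub> b} = s `` (r `` {a \<otimes>\<^bsub>M\<^esub> b})"
    using open_congs_refl[OF M r] open_congs_trans[OF M s] rs a b by blast
  ultimately show "(x \<otimes>\<^bsub>completion M\<^esub> y) s = s `` (x \<otimes>\<^bsub>completion M\<^esub> y) r"
    by simp
qed

lemma to_limit_mult:
  assumes "m \<in> carrier M" "n \<in> carrier M"
  shows "to_limit M (m \<otimes>\<^bsub>M\<^esub> n) = to_limit M m \<otimes>\<^bsub>completion M\<^esub> to_limit M n"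
proof (rule limit_carrier_ext)
  fix r assume r: "r \<in> open_congs M"
  then show "to_limit M (m \<otimes>\<^bsub>M\<^esub> n) r = (to_limit M m \<otimes>\<^bsub>completion M\<^esub> to_limit M n) r"
    using completion_mult_apply'[OF to_limit_in_limit_carrier to_limit_in_limit_carrier r, of m n m n]
      assms pull_cong_open_congs[OF M r]
    by (simp add: to_limit_apply)
qed (use assms in \<open>auto simp: to_limit_in_limit_carrier completion_mult_closed\<close>)

text \<open>For associativity both bracketings are evaluated with the same representatives
  \<open>a\<close>, \<open>b\<close>, \<open>c\<close>, each chosen at the index to which the
  previous ones shift; \<open>pull_cong_mult\<close> identifies the index of \<open>c\<close> on the
  two sides.\<close>

lemma monoid_completion: "monoid (completion M)"
proof (rule monoidI, unfold completion_simps)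
  show "\<And>x y. x \<in> limit_carrier M \<Longrightarrow> y \<in> limit_carrier M \<Longrightarrow> x \<otimes>\<^bsub>completion M\<^esub> y \<in> limit_carrier M"
    by (rule completion_mult_closed)
  show one: "to_limit M \<one>\<^bsub>M\<^esub> \<in> limit_carrier M" by (simp add: to_limit_in_limit_carrier)
  show "to_limit M \<one>\<^bsub>M\<^esub> \<otimes>\<^bsub>completion M\<^esub> x = x" if x: "x \<in> limit_carrier M" for x
  proof (rule limit_carrier_ext[OF completion_mult_closed[OF one x] x])
    fix r assume r: "r \<in> open_congs M"
    have p: "pull_cong M \<one>\<^bsub>M\<^esub> r = r"
      unfolding pull_cong_def using open_congs_memD[OF M r] by auto
    obtain a where a: "a \<in> carrier M" "x r = r `` {a}"
      by (rule limit_carrier_classE[OF x r])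
    show "(to_limit M \<one>\<^bsub>M\<^esub> \<otimes>\<^bsub>completion M\<^esub> x) r = x r"
      using completion_mult_apply'[OF one x r, of "\<one>\<^bsub>M\<^esub>" a] a r by (simp add: to_limit_apply p)
  qed
  show "x \<otimes>\<^bsub>completion M\<^esub> to_limit M \<one>\<^bsub>M\<^esub> = x" if x: "x \<in> limit_carrier M" for x
  proof (rule limit_carrier_ext[OF completion_mult_closed[OF x one] x])
    fix r assume r: "r \<in> open_congs M"
    obtain a where a: "a \<in> carrier M" "x r = r `` {a}"
      by (rule limit_carrier_classE[OF x r])
    show "(x \<otimes>\<^bsub>completion M\<^esub> to_limit M \<one>\<^bsub>M\<^esub>) r = x r"
      using completion_mult_apply'[OF x one r, of a "\<one>\<^bsub>M\<^esub>"] a pull_cong_open_congs[OF M r a(1)]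
      by (simp add: to_limit_apply)
  qed
  show "x \<otimes>\<^bsub>completion M\<^esub> y \<otimes>\<^bsub>completion M\<^esub> z = x \<otimes>\<^bsub>completion M\<^esub> (y \<otimes>\<^bsub>completion M\<^esub> z)"
    if x: "x \<in> limit_carrier M" and y: "y \<in> limit_carrier M" and z: "z \<in> limit_carrier M" for x y z
  proof (rule limit_carrier_ext)
    fix r assume r: "r \<in> open_congs M"
    obtain a where a: "a \<in> carrier M" "x r = r `` {a}"
      by (rule limit_carrier_classE[OF x r])
    note ra = pull_cong_open_congs[OF M r a(1)]
    obtain b where b: "b \<in> carrier M" "y (pull_cong M a r) = pull_cong M a r `` {b}"
      by (rule limit_carrier_classE[OF y ra])
    note rab = pull_cong_open_congs[OF M ra b(1)]
    obtain c where c: "c \<in> carrier M"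
        "z (pull_cong M b (pull_cong M a r)) = pull_cong M b (pull_cong M a r) `` {c}"
      by (rule limit_carrier_classE[OF z rab])
    have "(x \<otimes>\<^bsub>completion M\<^esub> y) r = r `` {a \<otimes>\<^bsub>M\<^esub> b}"
      by (rule completion_mult_apply'[OF x y r a b])
    moreover have "(y \<otimes>\<^bsub>completion M\<^esub> z) (pull_cong M a r) = pull_cong M a r `` {b \<otimes>\<^bsub>M\<^esub> c}"
      by (rule completion_mult_apply'[OF y z ra b c])
    ultimately show "(x \<otimes>\<^bsub>completion M\<^esub> y \<otimes>\<^bsub>completion M\<^esub> z) r =
        (x \<otimes>\<^bsub>completion M\<^esub> (y \<otimes>\<^bsub>completion M\<^esub> z)) r"
      using completion_mult_apply'[OF completion_mult_closed[OF x y] z r, of "a \<otimes>\<^bsub>M\<^esub> b" c]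
        completion_mult_apply'[OF x completion_mult_closed[OF y z] r, of a "b \<otimes>\<^bsub>M\<^esub> c"] a b c
      by (simp add: pull_cong_mult[OF monoid_axioms] m_assoc)
  qed (use x y z in \<open>auto intro: completion_mult_closed\<close>)
qed

section \<open>The topology of the limit and the map into it\<close>

text \<open>The index set is directed, so inside an intersection of two fibres of projections there
  is a single fibre through each point. Hence these fibres form a base and not merely a
  subbase.\<close>

lemma openin_completion:
  "openin (topol (completion M)) A \<longleftrightarrow>
     A \<subseteq> limit_carrier M \<and>
     (\<forall>x\<in>A. \<exists>r\<in>open_congs M. {y \<in> limit_carrier M. y r = x r} \<subseteq> A)" (is "_ \<longleftrightarrow> ?P A")
proof
  let ?B = "{{x \<in> limit_carrier M. x r \<in> S} | r S. r \<in> open_congs M \<and> S \<subseteq> carrier M // r}"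
  have top: "topol (completion M) = topology_generated_by ?B"
    by (simp add: completion_def)
  show "?P A" if "openin (topol (completion M)) A"
  proof -
    have "generate_topology_on ?B A"
      using that unfolding top by (rule openin_topology_generated_by)
    then show ?thesis
    proof induction
      case Empty then show ?case by simp
    next
      case (Int A B)
      note A = conjunct2[OF Int.IH(1), rule_format] and B = conjunct2[OF Int.IH(2), rule_format]
      have "\<exists>r\<in>open_congs M. {y \<in> limit_carrier M. y r = x r} \<subseteq> A \<inter> B" if xAB: "x \<in> A \<inter> B" for x
      proof -
        obtain r where r: "r \<in> open_congs M" "{y \<in> limit_carrier M. y r = x r} \<subseteq> A"
          using A[of x] xAB by auto
        obtain s where s: "s \<in> open_congs M" "{y \<in> limit_carrier M. y s = x s} \<subseteq> B"
          using B[of x] xAB by auto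
        have t: "r \<inter> s \<in> open_congs M" by (rule open_congs_Int[OF M r(1) s(1)])
        have x: "x \<in> limit_carrier M" using conjunct1[OF Int.IH(1)] xAB by blast
        have "y r = x r \<and> y s = x s" if "y \<in> limit_carrier M" "y (r \<inter> s) = x (r \<inter> s)" for y
          using limit_carrier_mono[OF that(1) t r(1)] limit_carrier_mono[OF that(1) t s(1)]
            limit_carrier_mono[OF x t r(1)] limit_carrier_mono[OF x t s(1)] that(2) by simp
        with r(2) s(2) have "{y \<in> limit_carrier M. y (r \<inter> s) = x (r \<inter> s)} \<subseteq> A \<inter> B"
          by auto
        with t show ?thesis by (rule bexI[rotated])
      qed
      then show ?case using conjunct1[OF Int.IH(1)] by auto
    next
      case (UN K)
      show ?case
      proof (intro conjI ballI)
        show "\<Union>K \<subseteq> limit_carrier M"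
          by (rule Union_least) (rule conjunct1[OF UN.IH])
        fix x assume "x \<in> \<Union>K"
        then obtain k where k: "k \<in> K" "x \<in> k" by blast
        obtain r where "r \<in> open_congs M" "{y \<in> limit_carrier M. y r = x r} \<subseteq> k"
          using bspec[OF conjunct2[OF UN.IH[OF k(1)]] k(2)] by blast
        with k(1) show "\<exists>r\<in>open_congs M. {y \<in> limit_carrier M. y r = x r} \<subseteq> \<Union>K" by blast
      qed
    next
      case (Basis s)
      then obtain r S where r: "r \<in> open_congs M" and s: "s = {x \<in> limit_carrier M. x r \<in> S}"
        by blast
      show ?case
        unfolding s by (intro conjI ballI bexI[OF _ r]) auto
    qed
  qed
  show "openin (topol (completion M)) A" if A: "?P A"
  proof -
    have "openin (topol (completion M)) {y \<in> limit_carrier M. y r = x r}"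
      if x: "x \<in> limit_carrier M" and r: "r \<in> open_congs M" for x r
    proof -
      have "{y \<in> limit_carrier M. y r \<in> {x r}} \<in> ?B"
        using r limit_carrier_in_quotient[OF x r] by blast
      then show ?thesis unfolding top by (auto intro: topology_generated_by_Basis)
    qed
    with A show ?thesis
      by (subst openin_subopen) blast
  qed
qed

lemma topspace_completion: "topspace (topol (completion M)) = limit_carrier M"
proof -
  have "openin (topol (completion M)) (limit_carrier M)"
    unfolding openin_completion using open_congs_UNIV[OF M] by blast
  then have "limit_carrier M \<subseteq> topspace (topol (completion M))"
    by (rule openin_subset)
  moreover have "topspace (topol (completion M)) \<subseteq> limit_carrier M"
    using openin_topspace[of "topol (completion M)", unfolded openin_completion] by (rule conjunct1)
  ultimately show ?thesis by (rule subset_antisym[rotated])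
qed

lemma openin_completion_nbhd:
  "r \<in> open_congs M \<Longrightarrow> openin (topol (completion M)) {y \<in> limit_carrier M. y r = c}"
  unfolding openin_completion by auto

text \<open>The component of \<open>x y\<close> at \<open>r\<close> depends only on that of
  \<open>x\<close> at \<open>r\<close> and on that of \<open>y\<close> at the index shifted by a
  representative of \<open>x\<close>. The basic neighbourhoods at these two indices therefore
  multiply into the given one.\<close>

lemma topological_monoid_completion: "topological_monoid (completion M)"
  unfolding topological_monoid_def
proof (intro conjI)
  let ?T = "topol (completion M)"
  show "monoid (completion M)" by (rule monoid_completion)
  show "topspace ?T = carrier (completion M)"
    by (simp add: topspace_completion completion_simps)
  show "continuous_map (prod_topology ?T ?T) ?T (\<lambda>(x, y). x \<otimes>\<^bsub>completion M\<^esub> y)"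
    unfolding continuous_map_def
  proof (intro conjI allI impI)
    show "(\<lambda>(x, y). x \<otimes>\<^bsub>completion M\<^esub> y) \<in> topspace (prod_topology ?T ?T) \<rightarrow> topspace ?T"
      by (auto simp: topspace_completion completion_mult_closed)
    fix A assume A: "openin ?T A"
    let ?P = "{z \<in> topspace (prod_topology ?T ?T). (case z of (x, y) \<Rightarrow> x \<otimes>\<^bsub>completion M\<^esub> y) \<in> A}"
    show "openin (prod_topology ?T ?T) ?P"
      unfolding openin_prod_topology_alt
    proof (intro allI impI)
      fix x y assume "(x, y) \<in> ?P"
      then have x: "x \<in> limit_carrier M" and y: "y \<in> limit_carrier M"
        and xy: "x \<otimes>\<^bsub>completion M\<^esub> y \<in> A" by (auto simp: topspace_completion)
      obtain r where r: "r \<in> open_congs M"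
        and sub: "{z \<in> limit_carrier M. z r = (x \<otimes>\<^bsub>completion M\<^esub> y) r} \<subseteq> A"
        using A xy unfolding openin_completion by blast
      obtain a where a: "a \<in> carrier M" "x r = r `` {a}"
        by (rule limit_carrier_classE[OF x r])
      let ?s = "pull_cong M a r"
      have s: "?s \<in> open_congs M" by (rule pull_cong_open_congs[OF M r a(1)])
      obtain b where b: "b \<in> carrier M" "y ?s = ?s `` {b}"
        by (rule limit_carrier_classE[OF y s])
      let ?U = "{x' \<in> limit_carrier M. x' r = x r}" and ?V = "{y' \<in> limit_carrier M. y' ?s = y ?s}"
      have "x' \<otimes>\<^bsub>completion M\<^esub> y' \<in> A" if "x' \<in> ?U" "y' \<in> ?V" for x' y'
      proof -
        have "(x' \<otimes>\<^bsub>completion M\<^esub> y') r = (x \<otimes>\<^bsub>completion M\<^esub> y) r"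
          using completion_mult_apply'[OF x y r a b] completion_mult_apply'[of x' y' r a b] that r a b
          by simp
        then show ?thesis using sub that completion_mult_closed by blast
      qed
      then have "?U \<times> ?V \<subseteq> ?P"
        by (auto simp: topspace_completion)
      moreover have "openin ?T ?U" "openin ?T ?V" "x \<in> ?U" "y \<in> ?V"
        using openin_completion_nbhd r s x y by auto
      ultimately show "\<exists>U V. openin ?T U \<and> openin ?T V \<and> x \<in> U \<and> y \<in> V \<and> U \<times> V \<subseteq> ?P"
        by (intro exI[of _ ?U] exI[of _ ?V]) simp
    qed
  qed
qed

text \<open>The preimage of the basic neighbourhood of \<open>u(m)\<close> at \<open>r\<close> is
  the class of \<open>m\<close>, which is open.\<close>

lemma continuous_map_to_limit: "continuous_map (topol M) (topol (completion M)) (to_limit M)"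
  unfolding continuous_map_def
proof (intro conjI allI impI)
  show "to_limit M \<in> topspace (topol M) \<rightarrow> topspace (topol (completion M))"
    by (auto simp: topspace_completion topological_monoidD(2)[OF M] to_limit_in_limit_carrier)
  fix A assume A: "openin (topol (completion M)) A"
  let ?P = "{m \<in> topspace (topol M). to_limit M m \<in> A}"
  have "\<exists>T. openin (topol M) T \<and> m \<in> T \<and> T \<subseteq> ?P" if "m \<in> ?P" for m
  proof -
    have m: "m \<in> carrier M" "to_limit M m \<in> A" using that by (auto simp: topological_monoidD(2)[OF M])
    obtain r where r: "r \<in> open_congs M" "{y \<in> limit_carrier M. y r = to_limit M m r} \<subseteq> A"
      using A m(2) unfolding openin_completion by blast
    have "to_limit M n \<in> A \<and> n \<in> carrier M" if "(m, n) \<in> r" for n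
    proof -
      have n: "n \<in> carrier M" using open_congs_memD[OF M r(1) that] by blast
      then have "to_limit M n r = to_limit M m r"
        using that open_congs_class_eq_iff[OF M r(1) m(1) n] r(1) by (simp add: to_limit_apply)
      then show ?thesis using r(2) n to_limit_in_limit_carrier by blast
    qed
    then show ?thesis
      using open_congs_openin[OF M r(1) m(1)] open_congs_refl[OF M r(1) m(1)]
      by (intro exI[of _ "r `` {m}"]) (auto simp: topological_monoidD(2)[OF M])
  qed
  then show "openin (topol M) ?P"
    by (subst openin_subopen) blast
qed

end

section \<open>Copies of the completion are complete\<close>

text \<open>Mirrors the clauses on \<open>u\<close> in \<open>complete_monoid\<close>, so that for a
  complete monoid \<open>u\<close> itself is an instance.\<close>

definition topmonoid_iso :: "'a topmonoid \<Rightarrow> 'b topmonoid \<Rightarrow> ('a \<Rightarrow> 'b) \<Rightarrow> bool" where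
  "topmonoid_iso N K \<pi> \<longleftrightarrow>
     \<pi> \<in> iso N K \<and> \<pi> \<one>\<^bsub>N\<^esub> = \<one>\<^bsub>K\<^esub> \<and> homeomorphic_map (topol N) (topol K) \<pi>"

text \<open>Transport of structure along \<open>e\<close>. The topology is pulled back along the
  inverse \<open>\<pi>\<close>, so that a map into the carrier of \<open>N\<close> is continuous
  once its composite with \<open>\<pi>\<close> is. This lets a monoid on the carrier type of the
  2-category stand in for the completion.\<close>

lemma ex_topmonoid_iso_image:
  fixes e :: "'a \<Rightarrow> 'b"
  assumes K: "topological_monoid K" and e: "inj_on e (carrier K)"
  shows "\<exists>N \<pi>. carrier N = e ` carrier K \<and> topological_monoid N \<and> topmonoid_iso N K \<pi>"
proof -
  define \<pi> where "\<pi> = inv_into (carrier K) e"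
  have \<pi>e: "\<pi> (e x) = x" if "x \<in> carrier K" for x
    using e that by (simp add: \<pi>_def)
  define N where "N = \<lparr>carrier = e ` carrier K, mult = (\<lambda>x y. e (\<pi> x \<otimes>\<^bsub>K\<^esub> \<pi> y)), one = e \<one>\<^bsub>K\<^esub>,
    topol = pullback_topology (e ` carrier K) \<pi> (topol K)\<rparr>"
  interpret K: monoid K by (rule topological_monoidD(1)[OF K])
  note tK = topological_monoidD(2)[OF K]
  have N: "monoid N"
    by (rule monoidI) (auto simp: N_def \<pi>e K.m_assoc)
  have tN: "topspace (topol N) = carrier N"
    using tK by (auto simp: N_def topspace_pullback_topology \<pi>e)
  have \<pi>c: "continuous_map (topol N) (topol K) \<pi>"
    using continuous_map_pullback[of "topol K" "topol K" id] by (simp add: N_def)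
  have bij: "bij_betw \<pi> (carrier N) (carrier K)"
    using e unfolding \<pi>_def N_def by (simp add: bij_betw_inv_into inj_on_imp_bij_betw)
  have mult: "\<pi> (x \<otimes>\<^bsub>N\<^esub> y) = \<pi> x \<otimes>\<^bsub>K\<^esub> \<pi> y" if "x \<in> carrier N" "y \<in> carrier N" for x y
    using that by (auto simp: N_def \<pi>e)
  have "continuous_map (prod_topology (topol N) (topol N)) (topol N) (\<lambda>(x, y). x \<otimes>\<^bsub>N\<^esub> y)"
  proof -
    let ?P = "prod_topology (topol N) (topol N)"
    have c: "continuous_map ?P (topol K) (\<lambda>z. \<pi> (fst z))" "continuous_map ?P (topol K) (\<lambda>z. \<pi> (snd z))"
      using continuous_map_compose[OF continuous_map_fst \<pi>c] continuous_map_compose[OF continuous_map_snd \<pi>c]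
      by (simp_all add: o_def)
    have "continuous_map ?P (topol K) (\<pi> \<circ> (\<lambda>(x, y). x \<otimes>\<^bsub>N\<^esub> y))"
      by (rule continuous_map_eq[OF continuous_map_mult[OF K c]]) (auto simp: tN mult)
    moreover have "topspace ?P \<subseteq> (\<lambda>(x, y). x \<otimes>\<^bsub>N\<^esub> y) -` carrier N"
      using monoid.m_closed[OF N] by (auto simp: tN)
    ultimately have "continuous_map ?P (pullback_topology (carrier N) \<pi> (topol K)) (\<lambda>(x, y). x \<otimes>\<^bsub>N\<^esub> y)"
      by (rule continuous_map_pullback')
    then show ?thesis by (simp add: N_def)
  qed
  then have tmN: "topological_monoid N"
    unfolding topological_monoid_def using N tN by simp
  have "open_map (topol N) (topol K) \<pi>"
    unfolding open_map_def
  proof (intro allI impI)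
    fix U assume "openin (topol N) U"
    then obtain W where W: "openin (topol K) W" "U = \<pi> -` W \<inter> e ` carrier K"
      by (auto simp: N_def openin_pullback_topology)
    have "W \<subseteq> carrier K" using openin_subset[OF W(1)] tK by simp
    then have "\<pi> ` U = W" by (force simp: W(2) \<pi>e image_iff)
    with W show "openin (topol K) (\<pi> ` U)" by simp
  qed
  with bij \<pi>c have "homeomorphic_map (topol N) (topol K) \<pi>"
    by (intro bijective_open_imp_homeomorphic_map) (auto simp: tN tK bij_betw_def)
  moreover have "\<pi> \<in> iso N K"
    using bij mult by (auto simp: iso_def hom_def bij_betw_def)
  moreover have "\<pi> \<one>\<^bsub>N\<^esub> = \<one>\<^bsub>K\<^esub>" by (simp add: N_def \<pi>e)
  ultimately show ?thesis
    using tmN by (intro exI[of _ N] exI[of _ \<pi>]) (simp add: topmonoid_iso_def, simp add: N_def)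
qed

text \<open>Multiplicativity and continuity of \<open>u\<close> hold for every topological monoid,
  so bijectivity and openness remain. Openness follows once the classes of open congruences form a
  neighbourhood base: by surjectivity the basic neighbourhood of \<open>u(x)\<close> at
  \<open>r\<close> is the image of the class of \<open>x\<close>.\<close>

lemma complete_monoidI:
  assumes M: "topological_monoid M"
    and bij: "bij_betw (to_limit M) (carrier M) (limit_carrier M)"
    and nbhd: "\<And>A x. openin (topol M) A \<Longrightarrow> x \<in> A \<Longrightarrow> \<exists>r\<in>open_congs M. r `` {x} \<subseteq> A"
  shows "complete_monoid M"
proof -
  note tM = topological_monoidD(2)[OF M] and tL = topspace_completion[OF M]
  have "open_map (topol M) (topol (completion M)) (to_limit M)"
    unfolding open_map_def
  proof (intro allI impI)
    fix A assume A: "openin (topol M) A"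
    then have Ac: "A \<subseteq> carrier M" using openin_subset tM by blast
    show "openin (topol (completion M)) (to_limit M ` A)"
      unfolding openin_completion[OF M]
    proof (intro conjI ballI)
      show "to_limit M ` A \<subseteq> limit_carrier M"
        using to_limit_in_limit_carrier[OF M] Ac by blast
      fix z assume "z \<in> to_limit M ` A"
      then obtain x where x: "x \<in> A" "z = to_limit M x" by blast
      obtain r where r: "r \<in> open_congs M" "r `` {x} \<subseteq> A" using nbhd[OF A x(1)] by blast
      have "y \<in> to_limit M ` A" if y: "y \<in> limit_carrier M" "y r = z r" for y
      proof -
        obtain w where w: "w \<in> carrier M" "y = to_limit M w"
          using y bij by (auto simp: bij_betw_def)
        then have "r `` {w} = r `` {x}"
          using y r by (simp add: x(2) to_limit_apply)
        then have "w \<in> r `` {x}"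
          using open_congs_refl[OF M r(1) w(1)] by blast
        with r w show ?thesis by blast
      qed
      with r show "\<exists>r\<in>open_congs M. {y \<in> limit_carrier M. y r = z r} \<subseteq> to_limit M ` A" by blast
    qed
  qed
  then have "homeomorphic_map (topol M) (topol (completion M)) (to_limit M)"
    using bij continuous_map_to_limit[OF M]
    by (intro bijective_open_imp_homeomorphic_map) (auto simp: tM tL bij_betw_def)
  moreover have "to_limit M \<in> iso M (completion M)"
    unfolding iso_def hom_def
    using bij to_limit_mult[OF M] to_limit_in_limit_carrier[OF M] by (auto simp: completion_simps)
  ultimately show ?thesis
    unfolding complete_monoid_def using M by (simp add: completion_simps)
qed

lemma complete_monoidD:
  assumes M: "complete_monoid M"
  shows "topological_monoid M"
    and "topmonoid_iso M (completion M) (to_limit M)"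
proof -
  show tm: "topological_monoid M" using M unfolding complete_monoid_def by blast
  show "topmonoid_iso M (completion M) (to_limit M)"
    using M unfolding complete_monoid_def topmonoid_iso_def by blast
qed

text \<open>The completion lives on a function type, whereas all objects of \<open>CMon\<close> share one carrier
  type; hence \<open>N\<close> is only isomorphic to it.\<close>

locale completed =
  fixes M :: "'a topmonoid" and N :: "'b topmonoid" and \<pi> :: "'b \<Rightarrow> ('a \<times> 'a) set \<Rightarrow> 'a set"
  assumes M: "topological_monoid M" and N: "topological_monoid N"
    and \<pi>: "topmonoid_iso N (completion M) \<pi>"
begin

lemma tops: "topspace (topol M) = carrier M" "topspace (topol N) = carrier N"
  using topological_monoidD(2) M N by auto

lemma bij_\<pi>: "bij_betw \<pi> (carrier N) (limit_carrier M)"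
  using \<pi> by (simp add: topmonoid_iso_def iso_def completion_simps)

lemma \<pi>_in: "x \<in> carrier N \<Longrightarrow> \<pi> x \<in> limit_carrier M"
  using bij_\<pi> by (auto simp: bij_betw_def)

lemma \<pi>_inj: "x \<in> carrier N \<Longrightarrow> y \<in> carrier N \<Longrightarrow> \<pi> x = \<pi> y \<Longrightarrow> x = y"
  using bij_\<pi> by (auto simp: bij_betw_def inj_on_def)

lemma \<pi>_surj: "z \<in> limit_carrier M \<Longrightarrow> \<exists>x\<in>carrier N. \<pi> x = z"
  using bij_\<pi> unfolding bij_betw_def by (metis imageE)

lemma \<pi>_mult: "x \<in> carrier N \<Longrightarrow> y \<in> carrier N \<Longrightarrow> \<pi> (x \<otimes>\<^bsub>N\<^esub> y) = \<pi> x \<otimes>\<^bsub>completion M\<^esub> \<pi> y"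
  using \<pi> by (simp add: topmonoid_iso_def iso_def hom_def)

lemma \<pi>_eqI:
  "x \<in> carrier N \<Longrightarrow> y \<in> carrier N \<Longrightarrow> (\<And>r. r \<in> open_congs M \<Longrightarrow> \<pi> x r = \<pi> y r) \<Longrightarrow> x = y"
  by (rule \<pi>_inj; (rule limit_carrier_ext)?) (auto simp: \<pi>_in)

section \<open>The unit of a completed monoid and its density\<close>

text \<open>The map \<open>u\<close> read in \<open>N\<close>; restricting it to the carrier makes
  it extensional, as a 1-cell has to be.\<close>

definition unit_map :: "'a \<Rightarrow> 'b" where
  "unit_map = (\<lambda>m\<in>carrier M. inv_into (carrier N) \<pi> (to_limit M m))"

lemma unit_map_in: "m \<in> carrier M \<Longrightarrow> unit_map m \<in> carrier N"
  using bij_\<pi> to_limit_in_limit_carrier[OF M]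
  by (auto simp: unit_map_def bij_betw_def intro!: inv_into_into)

lemma \<pi>_unit_map: "m \<in> carrier M \<Longrightarrow> \<pi> (unit_map m) = to_limit M m"
  using bij_\<pi> to_limit_in_limit_carrier[OF M]
  by (simp add: unit_map_def bij_betw_inv_into_right)

lemma \<pi>_unit_map_apply: "m \<in> carrier M \<Longrightarrow> r \<in> open_congs M \<Longrightarrow> \<pi> (unit_map m) r = r `` {m}"
  by (simp add: \<pi>_unit_map to_limit_apply)

lemma unit_map_one: "unit_map \<one>\<^bsub>M\<^esub> = \<one>\<^bsub>N\<^esub>"
proof (rule \<pi>_inj)
  show "unit_map \<one>\<^bsub>M\<^esub> \<in> carrier N" "\<one>\<^bsub>N\<^esub> \<in> carrier N"
    using monoid.one_closed topological_monoidD(1) M N unit_map_in by blast+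
  show "\<pi> (unit_map \<one>\<^bsub>M\<^esub>) = \<pi> \<one>\<^bsub>N\<^esub>"
    using \<pi> \<pi>_unit_map monoid.one_closed[OF topological_monoidD(1)[OF M]]
    by (simp add: topmonoid_iso_def completion_simps)
qed

lemma unit_map_mult:
  assumes "m \<in> carrier M" "n \<in> carrier M"
  shows "unit_map (m \<otimes>\<^bsub>M\<^esub> n) = unit_map m \<otimes>\<^bsub>N\<^esub> unit_map n"
  using assms monoid.m_closed[OF topological_monoidD(1)[OF M]] monoid.m_closed[OF topological_monoidD(1)[OF N]]
  by (intro \<pi>_inj) (simp_all add: unit_map_in \<pi>_mult \<pi>_unit_map to_limit_mult[OF M])

lemma openin_class: "r \<in> open_congs M \<Longrightarrow> openin (topol N) {y \<in> carrier N. \<pi> y r = c}"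
proof -
  assume r: "r \<in> open_congs M"
  have "continuous_map (topol N) (topol (completion M)) \<pi>"
    using \<pi> by (simp add: topmonoid_iso_def homeomorphic_imp_continuous_map)
  from openin_continuous_map_preimage[OF this openin_completion_nbhd[OF M r]]
  have "openin (topol N) {y \<in> topspace (topol N). \<pi> y \<in> {z \<in> limit_carrier M. z r = c}}" .
  also have "{y \<in> topspace (topol N). \<pi> y \<in> {z \<in> limit_carrier M. z r = c}} = {y \<in> carrier N. \<pi> y r = c}"
    using tops \<pi>_in by auto
  finally show ?thesis .
qed

lemma openin_nbhd:
  assumes A: "openin (topol N) A" and x: "x \<in> A"
  shows "\<exists>r\<in>open_congs M. {y \<in> carrier N. \<pi> y r = \<pi> x r} \<subseteq> A"
proof -
  have Ac: "A \<subseteq> carrier N" using openin_subset[OF A] tops by simp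
  have "openin (topol (completion M)) (\<pi> ` A)"
    using \<pi> A homeomorphic_imp_open_map unfolding topmonoid_iso_def open_map_def by blast
  then obtain r where r: "r \<in> open_congs M" "{z \<in> limit_carrier M. z r = \<pi> x r} \<subseteq> \<pi> ` A"
    using x unfolding openin_completion[OF M] by blast
  have "y \<in> A" if y: "y \<in> carrier N" "\<pi> y r = \<pi> x r" for y
  proof -
    have "\<pi> y \<in> \<pi> ` A" using r(2) y \<pi>_in by blast
    then show ?thesis using \<pi>_inj y(1) Ac by (metis imageE subsetD)
  qed
  with r(1) show ?thesis by blast
qed

lemma continuous_map_unit_map: "continuous_map (topol M) (topol N) unit_map"
  unfolding continuous_map_def
proof (intro conjI allI impI)
  show "unit_map \<in> topspace (topol M) \<rightarrow> topspace (topol N)"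
    using unit_map_in tops by auto
  fix A assume A: "openin (topol N) A"
  let ?P = "{m \<in> topspace (topol M). unit_map m \<in> A}"
  have "\<exists>T. openin (topol M) T \<and> m \<in> T \<and> T \<subseteq> ?P" if "m \<in> ?P" for m
  proof -
    have m: "m \<in> carrier M" "unit_map m \<in> A" using that tops by auto
    obtain r where r: "r \<in> open_congs M" "{y \<in> carrier N. \<pi> y r = \<pi> (unit_map m) r} \<subseteq> A"
      using openin_nbhd[OF A m(2)] by blast
    have "unit_map n \<in> A \<and> n \<in> carrier M" if "(m, n) \<in> r" for n
    proof -
      have n: "n \<in> carrier M" using open_congs_memD[OF M r(1) that] by blast
      then have "\<pi> (unit_map n) r = \<pi> (unit_map m) r"
        using that open_congs_class_eq_iff[OF M r(1) m(1) n] r(1) m(1) by (simp add: \<pi>_unit_map_apply)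
      then show ?thesis using r(2) n unit_map_in by blast
    qed
    then show ?thesis
      using open_congs_openin[OF M r(1) m(1)] open_congs_refl[OF M r(1) m(1)]
      by (intro exI[of _ "r `` {m}"]) (auto simp: tops)
  qed
  then show "openin (topol M) ?P"
    by (subst openin_subopen) blast
qed

lemma unit_map_class:
  assumes "x \<in> carrier N" "r \<in> open_congs M" "m \<in> \<pi> x r"
  shows "m \<in> carrier M" "\<pi> (unit_map m) r = \<pi> x r"
  using limit_carrier_class_eq[OF M \<pi>_in[OF assms(1)] assms(2,3)] assms
  by (simp_all add: \<pi>_unit_map_apply)

text \<open>Sharper than density: the approximating point comes from an \<open>m\<close> in a
  prescribed class. If the fibre at \<open>t\<close> through \<open>x\<close> lies in
  \<open>A\<close>, a representative of \<open>x\<close> at \<open>r \<inter> t\<close> lies in the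
  components at both \<open>r\<close> and \<open>t\<close>. In \<open>ex_lift_cong\<close> this is
  applied to a class \<open>A\<close> of a congruence of \<open>N\<close> and the restriction
  \<open>r\<close> of that congruence to \<open>M\<close>.\<close>

lemma openin_meets_unit_map:
  assumes A: "openin (topol N) A" and x: "x \<in> A" and r: "r \<in> open_congs M"
  shows "\<exists>m \<in> \<pi> x r. unit_map m \<in> A"
proof -
  have xc: "x \<in> carrier N" using openin_subset[OF A] tops x by auto
  obtain t where t: "t \<in> open_congs M" "{y \<in> carrier N. \<pi> y t = \<pi> x t} \<subseteq> A"
    using openin_nbhd[OF A x] by blast
  have rt: "r \<inter> t \<in> open_congs M" by (rule open_congs_Int[OF M r t(1)])
  obtain m where m: "m \<in> carrier M" "m \<in> \<pi> x (r \<inter> t)"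
    by (rule limit_carrier_classE[OF M \<pi>_in[OF xc] rt])
  have "m \<in> \<pi> x r" "m \<in> \<pi> x t"
    using limit_carrier_mono[OF \<pi>_in[OF xc] rt r] limit_carrier_mono[OF \<pi>_in[OF xc] rt t(1)]
      open_congs_refl[OF M r m(1)] open_congs_refl[OF M t(1) m(1)] m(2) by blast+
  then show ?thesis
    using unit_map_class[OF xc t(1)] t(2) unit_map_in[OF m(1)] by blast
qed

text \<open>At the total congruence the class prescribed in \<open>openin_meets_unit_map\<close> is
  no restriction.\<close>

lemma dense_unit_map: "topol N closure_of (unit_map ` carrier M) = carrier N"
proof
  show "topol N closure_of (unit_map ` carrier M) \<subseteq> carrier N"
    using closure_of_subset_topspace[of "topol N"] tops by simp
  show "carrier N \<subseteq> topol N closure_of (unit_map ` carrier M)"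
  proof
    fix x assume x: "x \<in> carrier N"
    have "\<exists>y. y \<in> unit_map ` carrier M \<and> y \<in> T" if "x \<in> T" "openin (topol N) T" for T
      using openin_meets_unit_map[OF that(2,1) open_congs_UNIV[OF M]]
        unit_map_class(1)[OF x open_congs_UNIV[OF M]] by blast
    then show "x \<in> topol N closure_of (unit_map ` carrier M)"
      unfolding in_closure_of using x tops by auto
  qed
qed

section \<open>Open congruences of the completed monoid and its completeness\<close>

text \<open>The kernel of the projection of \<open>N\<close> onto \<open>M/r\<close>.\<close>

definition lift_cong :: "('a \<times> 'a) set \<Rightarrow> ('b \<times> 'b) set" where
  "lift_cong r = {(x, y). x \<in> carrier N \<and> y \<in> carrier N \<and> \<pi> x r = \<pi> y r}"

text \<open>Right compatibility holds because the left factor enters the component of a product at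
  \<open>r\<close> only through its own component at \<open>r\<close>.\<close>

lemma lift_cong_open_congs:
  assumes r: "r \<in> open_congs M"
  shows "lift_cong r \<in> open_congs N"
proof -
  interpret N: monoid N by (rule topological_monoidD(1)[OF N])
  have "equiv (carrier N) (lift_cong r)"
    by (rule equivI) (auto simp: lift_cong_def refl_on_def sym_def trans_def)
  moreover have "(p \<otimes>\<^bsub>N\<^esub> m, q \<otimes>\<^bsub>N\<^esub> m) \<in> lift_cong r" if pqr: "(p, q) \<in> lift_cong r" and m: "m \<in> carrier N" for p q m
  proof -
    have p: "p \<in> carrier N" and q: "q \<in> carrier N" and pq: "\<pi> p r = \<pi> q r"
      using pqr by (auto simp: lift_cong_def)
    obtain a where a: "a \<in> carrier M" "\<pi> p r = r `` {a}"
      by (rule limit_carrier_classE[OF M \<pi>_in[OF p] r])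
    obtain b where b: "b \<in> carrier M" "\<pi> m (pull_cong M a r) = pull_cong M a r `` {b}"
      by (rule limit_carrier_classE[OF M \<pi>_in[OF m] pull_cong_open_congs[OF M r a(1)]])
    have "\<pi> (p \<otimes>\<^bsub>N\<^esub> m) r = r `` {a \<otimes>\<^bsub>M\<^esub> b}" "\<pi> (q \<otimes>\<^bsub>N\<^esub> m) r = r `` {a \<otimes>\<^bsub>M\<^esub> b}"
      using completion_mult_apply'[OF M \<pi>_in[OF p] \<pi>_in[OF m] r a b]
        completion_mult_apply'[OF M \<pi>_in[OF q] \<pi>_in[OF m] r a(1) _ b] a(2) pq p q m
      by (simp_all add: \<pi>_mult)
    with p q m show ?thesis by (simp add: lift_cong_def)
  qed
  moreover have "openin (topol N) (lift_cong r `` {x})" if "x \<in> carrier N" for x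
  proof -
    have "lift_cong r `` {x} = {y \<in> carrier N. \<pi> y r = \<pi> x r}"
      using that by (auto simp: lift_cong_def)
    then show ?thesis using openin_class[OF r] by simp
  qed
  ultimately show ?thesis
    unfolding open_congs_iff[OF N] right_congruence_def by blast
qed

text \<open>The index is the inverse image of \<open>s\<close> under the unit. Each class of
  \<open>s\<close> is open, so \<open>x\<close> is related by \<open>s\<close> to some
  \<open>unit_map m\<close> for which \<open>m\<close> also represents \<open>x\<close> at that
  index. Both relations between \<open>x\<close> and \<open>y\<close> thereby become the same
  relation between representatives in \<open>M\<close>.\<close>

lemma ex_lift_cong:
  assumes s: "s \<in> open_congs N"
  shows "\<exists>r\<in>open_congs M. s = lift_cong r"
proof -
  let ?r = "{(m, n). m \<in> carrier M \<and> n \<in> carrier M \<and> (unit_map m, unit_map n) \<in> s}"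
  have mult: "(unit_map (p \<otimes>\<^bsub>M\<^esub> m), unit_map (q \<otimes>\<^bsub>M\<^esub> m)) \<in> s"
    if "p \<in> carrier M" "q \<in> carrier M" "m \<in> carrier M" "(unit_map p, unit_map q) \<in> s" for p q m
    using open_congs_mult[OF N s that(4) unit_map_in[OF that(3)]] that by (simp add: unit_map_mult)
  have r: "?r \<in> open_congs M"
    by (rule open_congs_vimage[OF M N continuous_map_unit_map mult s])
  have rep: "\<exists>m \<in> \<pi> x ?r. m \<in> carrier M \<and> (x, unit_map m) \<in> s" if x: "x \<in> carrier N" for x
    using openin_meets_unit_map[OF open_congs_openin[OF N s x] _ r] open_congs_refl[OF N s x]
      unit_map_class(1)[OF x r] by blast
  have "(x, y) \<in> s \<longleftrightarrow> \<pi> x ?r = \<pi> y ?r" if x: "x \<in> carrier N" and y: "y \<in> carrier N" for x y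
  proof -
    obtain m where m: "m \<in> \<pi> x ?r" "m \<in> carrier M" "(x, unit_map m) \<in> s" using rep[OF x] by blast
    obtain n where n: "n \<in> \<pi> y ?r" "n \<in> carrier M" "(y, unit_map n) \<in> s" using rep[OF y] by blast
    have "\<pi> x ?r = ?r `` {m}" "\<pi> y ?r = ?r `` {n}"
      using conjunct2[OF limit_carrier_class_eq[OF M \<pi>_in[OF x] r m(1)]]
        conjunct2[OF limit_carrier_class_eq[OF M \<pi>_in[OF y] r n(1)]] .
    then have "\<pi> x ?r = \<pi> y ?r \<longleftrightarrow> (m, n) \<in> ?r"
      using open_congs_class_eq_iff[OF M r m(2) n(2)] by (simp only:)
    also have "\<dots> \<longleftrightarrow> (unit_map m, unit_map n) \<in> s" using m n by blast
    also have "\<dots> \<longleftrightarrow> (x, y) \<in> s"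
      using m(3) n(3) open_congs_sym[OF N s] open_congs_trans[OF N s] by meson
    finally show ?thesis by blast
  qed
  then have eq: "(x, y) \<in> s \<longleftrightarrow> (x, y) \<in> lift_cong ?r" for x y
    using open_congs_memD[OF N s, of x y] unfolding lift_cong_def by blast
  have "s = lift_cong ?r"
  proof (rule Set.set_eqI)
    show "z \<in> s \<longleftrightarrow> z \<in> lift_cong ?r" for z
      using eq[of "fst z" "snd z"] unfolding prod.collapse .
  qed
  with r show ?thesis by blast
qed

text \<open>By \<open>ex_lift_cong\<close> the limit for \<open>N\<close> is indexed by the open
  congruences of \<open>M\<close>, and \<open>lift_cong r\<close> has the same quotient as
  \<open>r\<close>; so the limit for \<open>N\<close> is the limit for \<open>M\<close>
  again.\<close>

lemma complete: "complete_monoid N"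
proof (rule complete_monoidI[OF N])
  fix A x assume A: "openin (topol N) A" and x: "x \<in> A"
  then obtain r where r: "r \<in> open_congs M" "{y \<in> carrier N. \<pi> y r = \<pi> x r} \<subseteq> A"
    using openin_nbhd by blast
  have "lift_cong r `` {x} \<subseteq> A"
    using r(2) by (auto simp: lift_cong_def)
  then show "\<exists>r\<in>open_congs N. r `` {x} \<subseteq> A"
    using lift_cong_open_congs[OF r(1)] by blast
next
  have class_eq: "lift_cong r `` {x} = lift_cong r `` {y} \<longleftrightarrow> \<pi> x r = \<pi> y r"
    if "r \<in> open_congs M" "x \<in> carrier N" "y \<in> carrier N" for r x y
    using open_congs_class_eq_iff[OF N lift_cong_open_congs[OF that(1)] that(2,3)] that(2,3)
    by (simp add: lift_cong_def)
  show "bij_betw (to_limit N) (carrier N) (limit_carrier N)"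
    unfolding bij_betw_def
  proof
    show "inj_on (to_limit N) (carrier N)"
    proof (rule inj_onI)
      fix x y assume x: "x \<in> carrier N" and y: "y \<in> carrier N" and eq: "to_limit N x = to_limit N y"
      show "x = y"
      proof (rule \<pi>_eqI[OF x y])
        fix r assume r: "r \<in> open_congs M"
        have "to_limit N x (lift_cong r) = to_limit N y (lift_cong r)" using eq by simp
        then show "\<pi> x r = \<pi> y r"
          using class_eq[OF r x y] by (simp add: to_limit_apply lift_cong_open_congs[OF r])
      qed
    qed
    show "to_limit N ` carrier N = limit_carrier N"
    proof
      show "to_limit N ` carrier N \<subseteq> limit_carrier N"
        using to_limit_in_limit_carrier[OF N] by blast
      show "limit_carrier N \<subseteq> to_limit N ` carrier N"
      proof
        fix z assume z: "z \<in> limit_carrier N"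
        \<comment> \<open>The component at \<open>r\<close> is the trace on \<open>M\<close> of the
          class picked by \<open>z\<close>. The fact that follows identifies it with
          \<open>\<pi> x r\<close> for any \<open>x\<close> representing \<open>z\<close> at
          \<open>lift_cong r\<close>.\<close>
        define w where "w = (\<lambda>r\<in>open_congs M. {m \<in> carrier M. unit_map m \<in> z (lift_cong r)})"
        have w: "w r = \<pi> x r" if r: "r \<in> open_congs M" and x: "x \<in> carrier N" "z (lift_cong r) = lift_cong r `` {x}" for r x
        proof -
          have "m \<in> w r \<longleftrightarrow> m \<in> \<pi> x r" for m
          proof -
            have "m \<in> w r \<longleftrightarrow> m \<in> carrier M \<and> \<pi> x r = r `` {m}"
              using r x by (auto simp: w_def lift_cong_def unit_map_in \<pi>_unit_map_apply)
            also have "\<dots> \<longleftrightarrow> m \<in> \<pi> x r"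
              using limit_carrier_class_eq[OF M \<pi>_in[OF x(1)] r, of m] open_congs_refl[OF M r, of m] by auto
            finally show ?thesis .
          qed
          then show ?thesis by blast
        qed
        have "w \<in> limit_carrier M"
        proof (rule limit_carrierI)
          show "w \<in> extensional (open_congs M)" by (simp add: w_def)
        next
          fix r assume r: "r \<in> open_congs M"
          obtain x where x: "x \<in> carrier N" "z (lift_cong r) = lift_cong r `` {x}"
            by (rule limit_carrier_classE[OF N z lift_cong_open_congs[OF r]])
          show "w r \<in> carrier M // r"
            using w[OF r x] limit_carrier_in_quotient[OF \<pi>_in[OF x(1)] r] by simp
        next
          fix r s assume r: "r \<in> open_congs M" and s: "s \<in> open_congs M" and rs: "r \<subseteq> s"
          \<comment> \<open>The component at \<open>s\<close> is the image of the one at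
            \<open>r\<close>, so agreement at \<open>r\<close> forces agreement at
            \<open>s\<close>.\<close>
          have sub: "lift_cong r \<subseteq> lift_cong s"
            using limit_carrier_mono[OF \<pi>_in r s rs] by (auto simp: lift_cong_def)
          obtain x where x: "x \<in> carrier N" "z (lift_cong r) = lift_cong r `` {x}" "x \<in> z (lift_cong r)"
            by (rule limit_carrier_classE[OF N z lift_cong_open_congs[OF r]])
          have "x \<in> z (lift_cong s)"
            using limit_carrier_mono[OF z lift_cong_open_congs[OF r] lift_cong_open_congs[OF s] sub] x
              open_congs_refl[OF N lift_cong_open_congs[OF s]] by blast
          then have "z (lift_cong s) = lift_cong s `` {x}"
            using limit_carrier_class_eq[OF N z lift_cong_open_congs[OF s]] by blast
          then show "w s = s `` w r"
            using w[OF r x(1,2)] w[OF s x(1)] limit_carrier_mono[OF \<pi>_in[OF x(1)] r s rs] by simp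
        qed
        then obtain y where y: "y \<in> carrier N" "\<pi> y = w" using \<pi>_surj by blast
        have "to_limit N y = z"
        proof (rule limit_carrier_ext[OF to_limit_in_limit_carrier[OF N y(1)] z])
          fix s assume s: "s \<in> open_congs N"
          \<comment> \<open>Every index on the side of \<open>N\<close> is some
            \<open>lift_cong r\<close>, so agreement at these suffices.\<close>
          then obtain r where r: "r \<in> open_congs M" "s = lift_cong r" using ex_lift_cong by blast
          obtain x where x: "x \<in> carrier N" "z (lift_cong r) = lift_cong r `` {x}"
            by (rule limit_carrier_classE[OF N z lift_cong_open_congs[OF r(1)]])
          have "\<pi> y r = \<pi> x r" using y w[OF r(1) x] by simp
          then show "to_limit N y s = z s"
            using class_eq[OF r(1) y(1) x(1)] x s r by (simp add: to_limit_apply)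
        qed
        with y show "z \<in> to_limit N ` carrier N" by blast
      qed
    qed
  qed
qed

end

section \<open>Powder topology and extension of homomorphisms\<close>

text \<open>\<open>m \<in> A\<close> means that the unit lies in \<open>m^*(A)\<close>, so the
  translate class of a point of \<open>A\<close> stays inside \<open>A\<close>; it is open by the
  defining condition with \<open>q = 1\<close>.\<close>

lemma action_base_openin:
  assumes M: "topological_monoid M" and A: "A \<in> action_base M"
  shows "openin (topol M) A"
proof -
  interpret monoid M by (rule topological_monoidD(1)[OF M])
  have Ac: "A \<subseteq> carrier M" using A by (simp add: action_base_def)
  have one: "translate M \<one>\<^bsub>M\<^esub> A = A"
    using Ac by (auto simp: translate_def)
  have "\<exists>T. openin (topol M) T \<and> p \<in> T \<and> T \<subseteq> A" if p: "p \<in> A" for p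
  proof (intro exI conjI)
    have pc: "p \<in> carrier M" using Ac p by blast
    show "openin (topol M) (translate_class M A p)"
      using A pc one unfolding action_base_def by (metis (mono_tags, lifting) mem_Collect_eq one_closed)
    show "p \<in> translate_class M A p" using pc by (simp add: translate_class_def)
    show "translate_class M A p \<subseteq> A"
    proof
      fix m assume m: "m \<in> translate_class M A p"
      have "\<one>\<^bsub>M\<^esub> \<in> translate M p A" using p pc by (simp add: translate_def)
      then have "\<one>\<^bsub>M\<^esub> \<in> translate M m A" using m by (simp add: translate_class_def)
      then show "m \<in> A" using m by (simp add: translate_class_def translate_def)
    qed
  qed
  then show ?thesis by (subst openin_subopen) blast
qed

text \<open>With \<open>C\<close> the class, \<open>q^*(C)\<close> is saturated for
  \<open>q^*(r)\<close>, and elements congruent modulo \<open>q^*(r)\<close> have equal translates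
  of it, since right multiplication preserves this congruence. The translate class is therefore a
  union of open classes of \<open>q^*(r)\<close>.\<close>

lemma open_cong_class_action_base:
  assumes M: "topological_monoid M" and r: "r \<in> open_congs M"
  shows "r `` {x} \<in> action_base M"
  unfolding action_base_def
proof (intro CollectI conjI ballI)
  interpret monoid M by (rule topological_monoidD(1)[OF M])
  let ?C = "r `` {x}"
  show "?C \<subseteq> carrier M" using open_congs_memD[OF M r] by blast
  fix p q assume p: "p \<in> carrier M" and q: "q \<in> carrier M"
  let ?I = "translate_class M (translate M q ?C) p"
  have s: "pull_cong M q r \<in> open_congs M" by (rule pull_cong_open_congs[OF M r q])
  have "\<exists>T. openin (topol M) T \<and> m \<in> T \<and> T \<subseteq> ?I" if m: "m \<in> ?I" for m
  proof (intro exI conjI)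
    have mc: "m \<in> carrier M" using m by (simp add: translate_class_def)
    show "openin (topol M) (pull_cong M q r `` {m})" by (rule open_congs_openin[OF M s mc])
    show "m \<in> pull_cong M q r `` {m}" using open_congs_refl[OF M s mc] by blast
    show "pull_cong M q r `` {m} \<subseteq> ?I"
    proof
      fix n assume n: "n \<in> pull_cong M q r `` {m}"
      then have nc: "n \<in> carrier M" and mn: "(q \<otimes>\<^bsub>M\<^esub> m, q \<otimes>\<^bsub>M\<^esub> n) \<in> r"
        by (auto simp: pull_cong_def)
      have "q \<otimes>\<^bsub>M\<^esub> (m \<otimes>\<^bsub>M\<^esub> k) \<in> ?C \<longleftrightarrow> q \<otimes>\<^bsub>M\<^esub> (n \<otimes>\<^bsub>M\<^esub> k) \<in> ?C" if k: "k \<in> carrier M" for k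
      proof -
        have "(q \<otimes>\<^bsub>M\<^esub> (m \<otimes>\<^bsub>M\<^esub> k), q \<otimes>\<^bsub>M\<^esub> (n \<otimes>\<^bsub>M\<^esub> k)) \<in> r"
          using open_congs_mult[OF M r mn k] q mc nc k by (simp add: m_assoc)
        then show ?thesis
          using open_congs_sym[OF M r] open_congs_trans[OF M r] by (meson Image_singleton_iff)
      qed
      then have "translate M n (translate M q ?C) = translate M m (translate M q ?C)"
        using mc nc by (auto simp: translate_def)
      with m nc show "n \<in> ?I" by (simp add: translate_class_def)
    qed
  qed
  then show "openin (topol M) ?I" by (subst openin_subopen) blast
qed

context completed
begin

lemma Hausdorff: "Hausdorff_space (topol N)"
  unfolding Hausdorff_space_def
proof (intro allI impI)
  fix x y assume "x \<in> topspace (topol N) \<and> y \<in> topspace (topol N) \<and> x \<noteq> y"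
  then have x: "x \<in> carrier N" and y: "y \<in> carrier N" and "x \<noteq> y" using tops by auto
  then obtain r where r: "r \<in> open_congs M" "\<pi> x r \<noteq> \<pi> y r" using \<pi>_eqI by blast
  show "\<exists>U V. openin (topol N) U \<and> openin (topol N) V \<and> x \<in> U \<and> y \<in> V \<and> disjnt U V"
    by (rule exI[of _ "{z \<in> carrier N. \<pi> z r = \<pi> x r}"], rule exI[of _ "{z \<in> carrier N. \<pi> z r = \<pi> y r}"])
      (use x y r openin_class[OF r(1)] in \<open>auto simp: disjnt_iff\<close>)
qed

text \<open>The classes of the congruences \<open>lift_cong r\<close> lie in the action base and
  already form a base of the topology; conversely the sets of the action base are open.\<close>

lemma powder: "powder_monoid N"
proof -
  have "openin (topol N) A \<longleftrightarrow> (arbitrary union_of (\<lambda>A. A \<in> action_base N)) A" for A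
  proof
    assume A: "openin (topol N) A"
    let ?F = "{lift_cong r `` {x} | r x. r \<in> open_congs M \<and> x \<in> A \<and> lift_cong r `` {x} \<subseteq> A}"
    have "?F \<subseteq> Collect (\<lambda>A. A \<in> action_base N)"
      using open_cong_class_action_base[OF N lift_cong_open_congs] by blast
    moreover have "\<Union>?F = A"
    proof
      show "A \<subseteq> \<Union>?F"
      proof
        fix x assume x: "x \<in> A"
        then have xc: "x \<in> carrier N" using openin_subset[OF A] tops by auto
        obtain r where r: "r \<in> open_congs M" "{y \<in> carrier N. \<pi> y r = \<pi> x r} \<subseteq> A"
          using openin_nbhd[OF A x] by blast
        have "lift_cong r `` {x} \<subseteq> A" using r(2) by (auto simp: lift_cong_def)
        moreover have "x \<in> lift_cong r `` {x}" using xc by (simp add: lift_cong_def)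
        ultimately show "x \<in> \<Union>?F" using r(1) x by blast
      qed
    qed blast
    ultimately show "(arbitrary union_of (\<lambda>A. A \<in> action_base N)) A"
      unfolding union_of_def arbitrary_def by blast
  next
    assume "(arbitrary union_of (\<lambda>A. A \<in> action_base N)) A"
    then obtain F where F: "F \<subseteq> action_base N" "\<Union>F = A"
      unfolding union_of_def arbitrary_def by blast
    then show "openin (topol N) A"
      using action_base_openin[OF N] by (metis openin_Union subsetD)
  qed
  then have "has_action_topology N"
    unfolding has_action_topology_def by blast
  then show ?thesis
    unfolding powder_monoid_def using N Hausdorff Hausdorff_imp_t0_space by blast
qed

lemma eq_on_dense:
  assumes "Hausdorff_space Z" "continuous_map (topol N) Z g" "continuous_map (topol N) Z h"
    and "\<And>m. m \<in> carrier M \<Longrightarrow> g (unit_map m) = h (unit_map m)" and "x \<in> carrier N"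
  shows "g x = h x"
  by (rule forall_in_closure_of_eq[OF _ assms(1-3), of x "unit_map ` carrier M"])
    (use assms(4,5) dense_unit_map in auto)

end

text \<open>A complete monoid is a completed copy of itself with \<open>u\<close> as the
  isomorphism, so facts about completions apply to it directly.\<close>

lemma complete_monoid_completed: "complete_monoid M \<Longrightarrow> completed M M (to_limit M)"
  by (simp add: completed_def complete_monoidD)

lemma complete_imp_powder: "complete_monoid M \<Longrightarrow> powder_monoid M"
  by (rule completed.powder[OF complete_monoid_completed])

lemma complete_imp_Hausdorff: "complete_monoid M \<Longrightarrow> Hausdorff_space (topol M)"
  by (rule completed.Hausdorff[OF complete_monoid_completed])

text \<open>Open congruences separate points, so an equation in a complete monoid can be checked
  modulo each of them. The extension constructed below is controlled in exactly this way.\<close>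

lemma complete_monoid_eqI:
  assumes Y: "complete_monoid Y" and x: "x \<in> carrier Y" and y: "y \<in> carrier Y"
    and eq: "\<And>s. s \<in> open_congs Y \<Longrightarrow> (x, y) \<in> s"
  shows "x = y"
proof -
  interpret Y: completed Y Y "to_limit Y" by (rule complete_monoid_completed[OF Y])
  show ?thesis
    by (rule Y.\<pi>_eqI[OF x y]) (simp add: to_limit_apply open_congs_class_eq_iff[OF Y.N _ x y] eq)
qed

section \<open>Extension of homomorphisms along the unit\<close>

text \<open>The value \<open>g x\<close> is pinned down by one relation: modulo each
  \<open>s\<close> it is \<open>f m\<close>, for every \<open>m\<close> in the component of
  \<open>x\<close> at the inverse image \<open>R s\<close>. The values on the unit, multiplicativity
  and continuity are all read off from this relation.\<close>

lemma (in completed) ex_extension: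
  assumes Y: "complete_monoid Y" and f: "f \<in> hom M Y" and fc: "continuous_map (topol M) (topol Y) f"
  shows "\<exists>g \<in> hom N Y. continuous_map (topol N) (topol Y) g \<and> (\<forall>m\<in>carrier M. g (unit_map m) = f m)"
proof -
  interpret Y: completed Y Y "to_limit Y" by (rule complete_monoid_completed[OF Y])
  interpret MM: monoid M by (rule topological_monoidD(1)[OF M])
  interpret NM: monoid N by (rule topological_monoidD(1)[OF N])
  interpret YM: monoid Y by (rule topological_monoidD(1)[OF Y.N])
  note Yt = Y.N
  have fin: "m \<in> carrier M \<Longrightarrow> f m \<in> carrier Y" for m
    using f by (auto simp: hom_def)
  have fmult: "m \<in> carrier M \<Longrightarrow> n \<in> carrier M \<Longrightarrow> f (m \<otimes>\<^bsub>M\<^esub> n) = f m \<otimes>\<^bsub>Y\<^esub> f n" for m n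
    using f by (auto simp: hom_def)
  define R where "R s = {(x, y). x \<in> carrier M \<and> y \<in> carrier M \<and> (f x, f y) \<in> s}" for s
  have R: "R s \<in> open_congs M" if s: "s \<in> open_congs Y" for s
  proof -
    have "(f (p \<otimes>\<^bsub>M\<^esub> m), f (q \<otimes>\<^bsub>M\<^esub> m)) \<in> s"
      if "p \<in> carrier M" "q \<in> carrier M" "m \<in> carrier M" "(f p, f q) \<in> s" for p q m
      using open_congs_mult[OF Yt s that(4) fin[OF that(3)]] that by (simp add: fmult)
    from open_congs_vimage[OF M Yt fc this s] show ?thesis unfolding R_def .
  qed
  have "\<exists>y\<in>carrier Y. \<forall>s\<in>open_congs Y. \<forall>m\<in>\<pi> x (R s). (f m, y) \<in> s" if x: "x \<in> carrier N" for x
  proof -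
    \<comment> \<open>All \<open>f m\<close> with \<open>m\<close> in one class of
      \<open>R s\<close> fall into one class of \<open>s\<close>. These classes form an element of
      the limit for \<open>Y\<close>, which completeness realises by a point.\<close>
    define z where "z = (\<lambda>s\<in>open_congs Y. s `` (f ` \<pi> x (R s)))"
    have z: "z s = s `` {f m}" if s: "s \<in> open_congs Y" and m: "m \<in> \<pi> x (R s)" for s m
    proof -
      have "s `` {f n} = s `` {f m}" if n: "n \<in> \<pi> x (R s)" for n
      proof -
        have "n \<in> R s `` {m}"
          using limit_carrier_class_eq[OF M \<pi>_in[OF x] R[OF s] m] n by blast
        then have "(f m, f n) \<in> s" by (simp add: R_def)
        then show ?thesis using equiv_class_eq[OF open_congs_equiv[OF Yt s]] by blast
      qed
      then have "s `` (f ` \<pi> x (R s)) = s `` {f m}" using m by blast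
      then show ?thesis using s by (simp add: z_def)
    qed
    have "z \<in> limit_carrier Y"
    proof (rule limit_carrierI)
      show "z \<in> extensional (open_congs Y)" by (simp add: z_def)
    next
      fix s assume s: "s \<in> open_congs Y"
      obtain m where m: "m \<in> carrier M" "m \<in> \<pi> x (R s)"
        by (rule limit_carrier_classE[OF M \<pi>_in[OF x] R[OF s]])
      show "z s \<in> carrier Y // s"
        by (simp add: z[OF s m(2)] quotientI fin m)
    next
      fix s t assume s: "s \<in> open_congs Y" and t: "t \<in> open_congs Y" and st: "s \<subseteq> t"
      obtain m where m: "m \<in> carrier M" "m \<in> \<pi> x (R s)"
        by (rule limit_carrier_classE[OF M \<pi>_in[OF x] R[OF s]])
      have "R s \<subseteq> R t" using st by (auto simp: R_def)
      then have "m \<in> \<pi> x (R t)"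
        using limit_carrier_mono[OF \<pi>_in[OF x] R[OF s] R[OF t]] m open_congs_refl[OF M R[OF t]] by blast
      then have "z t = t `` {f m}" by (rule z[OF t])
      moreover have "t `` {f m} = t `` (s `` {f m})"
        using open_congs_refl[OF Yt s fin[OF m(1)]] open_congs_trans[OF Yt t] st by blast
      ultimately show "z t = t `` z s" using z[OF s m(2)] by simp
    qed
    then obtain y where y: "y \<in> carrier Y" "to_limit Y y = z" using Y.\<pi>_surj by blast
    have "(f m, y) \<in> s" if s: "s \<in> open_congs Y" and m: "m \<in> \<pi> x (R s)" for s m
    proof -
      have "s `` {y} = s `` {f m}" using y(2) z[OF s m] to_limit_apply[OF s, of y] by simp
      then show ?thesis using open_congs_refl[OF Yt s y(1)] by blast
    qed
    with y(1) show ?thesis by blast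
  qed
  then obtain g where g: "\<And>x. x \<in> carrier N \<Longrightarrow> g x \<in> carrier Y"
    and gs: "\<And>x s m. x \<in> carrier N \<Longrightarrow> s \<in> open_congs Y \<Longrightarrow> m \<in> \<pi> x (R s) \<Longrightarrow> (f m, g x) \<in> s"
    by metis
  have unit: "g (unit_map m) = f m" if m: "m \<in> carrier M" for m
  proof (rule complete_monoid_eqI[OF Y])
    fix s assume s: "s \<in> open_congs Y"
    have "m \<in> \<pi> (unit_map m) (R s)"
      using open_congs_refl[OF M R[OF s] m] by (simp add: \<pi>_unit_map_apply m R s)
    from gs[OF unit_map_in[OF m] s this] show "(g (unit_map m), f m) \<in> s"
      by (rule open_congs_sym[OF Yt s])
  qed (auto simp: g unit_map_in m fin)
  have mult: "g (x \<otimes>\<^bsub>N\<^esub> y) = g x \<otimes>\<^bsub>Y\<^esub> g y" if x: "x \<in> carrier N" and y: "y \<in> carrier N" for x y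
  proof (rule complete_monoid_eqI[OF Y])
    fix s assume s: "s \<in> open_congs Y"
    obtain a where a: "a \<in> carrier M" "a \<in> \<pi> x (R s)"
      by (rule limit_carrier_classE[OF M \<pi>_in[OF x] R[OF s]])
    \<comment> \<open>Taking inverse images along \<open>f\<close> commutes with shifting the index,
      by \<open>a\<close> in \<open>M\<close> and by \<open>f a\<close> in \<open>Y\<close>.\<close>
    have pull: "pull_cong M a (R s) = R (pull_cong Y (f a) s)"
      using a fin by (auto simp: pull_cong_def R_def fmult)
    have ps: "pull_cong Y (f a) s \<in> open_congs Y" by (rule pull_cong_open_congs[OF Yt s fin[OF a(1)]])
    obtain b where b: "b \<in> carrier M" "b \<in> \<pi> y (R (pull_cong Y (f a) s))"
      by (rule limit_carrier_classE[OF M \<pi>_in[OF y] R[OF ps]])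
    have "\<pi> (x \<otimes>\<^bsub>N\<^esub> y) (R s) = R s `` {a \<otimes>\<^bsub>M\<^esub> b}"
      unfolding \<pi>_mult[OF x y]
      by (rule completion_mult_apply[OF M \<pi>_in[OF x] \<pi>_in[OF y] R[OF s] a(2)]) (use b pull in simp)
    then have "a \<otimes>\<^bsub>M\<^esub> b \<in> \<pi> (x \<otimes>\<^bsub>N\<^esub> y) (R s)"
      using open_congs_refl[OF M R[OF s]] a b by blast
    then have 1: "(f a \<otimes>\<^bsub>Y\<^esub> f b, g (x \<otimes>\<^bsub>N\<^esub> y)) \<in> s"
      using gs[OF NM.m_closed[OF x y] s, of "a \<otimes>\<^bsub>M\<^esub> b"] a b by (simp add: fmult)
    have 2: "(f a \<otimes>\<^bsub>Y\<^esub> g y, g x \<otimes>\<^bsub>Y\<^esub> g y) \<in> s"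
      by (rule open_congs_mult[OF Yt s gs[OF x s a(2)] g[OF y]])
    \<comment> \<open>A right congruence does not in general survive left multiplication. It does
      here because \<open>b\<close> was chosen at the index shifted by \<open>f a\<close>.\<close>
    have 3: "(f a \<otimes>\<^bsub>Y\<^esub> f b, f a \<otimes>\<^bsub>Y\<^esub> g y) \<in> s"
      using gs[OF y ps b(2)] by (simp add: pull_cong_def)
    show "(g (x \<otimes>\<^bsub>N\<^esub> y), g x \<otimes>\<^bsub>Y\<^esub> g y) \<in> s"
      by (rule open_congs_trans[OF Yt s open_congs_sym[OF Yt s 1] open_congs_trans[OF Yt s 3 2]])
  qed (auto simp: g x y)
  have "continuous_map (topol N) (topol Y) g"
    unfolding continuous_map_def
  proof (intro conjI allI impI)
    show "g \<in> topspace (topol N) \<rightarrow> topspace (topol Y)" using g tops Y.tops by auto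
    fix A assume A: "openin (topol Y) A"
    let ?P = "{x \<in> topspace (topol N). g x \<in> A}"
    have "\<exists>T. openin (topol N) T \<and> x \<in> T \<and> T \<subseteq> ?P" if "x \<in> ?P" for x
    proof -
      have x: "x \<in> carrier N" "g x \<in> A" using that tops by auto
      obtain s where s: "s \<in> open_congs Y" "{y \<in> carrier Y. to_limit Y y s = to_limit Y (g x) s} \<subseteq> A"
        using Y.openin_nbhd[OF A x(2)] by blast
      obtain m where m: "m \<in> carrier M" "m \<in> \<pi> x (R s)"
        by (rule limit_carrier_classE[OF M \<pi>_in[OF x(1)] R[OF s(1)]])
      \<comment> \<open>One representative \<open>m\<close> serves the whole fibre, so
        \<open>g\<close> sends the fibre into a single class of \<open>s\<close>.\<close>
      have "{y \<in> carrier N. \<pi> y (R s) = \<pi> x (R s)} \<subseteq> ?P"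
      proof
        fix y assume "y \<in> {y \<in> carrier N. \<pi> y (R s) = \<pi> x (R s)}"
        then have y: "y \<in> carrier N" "m \<in> \<pi> y (R s)" using m by auto
        have "(g y, g x) \<in> s"
          using gs[OF x(1) s(1) m(2)] gs[OF y(1) s(1) y(2)] open_congs_sym[OF Yt s(1)]
            open_congs_trans[OF Yt s(1)] by meson
        then have "to_limit Y (g y) s = to_limit Y (g x) s"
          using open_congs_class_eq_iff[OF Yt s(1) g[OF y(1)] g[OF x(1)]] s(1) by (simp add: to_limit_apply)
        then show "y \<in> ?P" using s(2) g[OF y(1)] y(1) tops by blast
      qed
      with openin_class[OF R[OF s(1)]] x(1) show ?thesis
        by (intro exI[of _ "{y \<in> carrier N. \<pi> y (R s) = \<pi> x (R s)}"]) simp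
    qed
    then show "openin (topol N) ?P" by (subst openin_subopen) blast
  qed
  moreover have "g \<in> hom N Y" using g mult by (auto simp: hom_def)
  ultimately show ?thesis using unit by blast
qed

text \<open>Two families with the same set of classes agree: distinct classes of one congruence are disjoint,
  while the classes of one family for two congruences meet.\<close>

lemma limit_carrier_lepoll:
  assumes M: "topological_monoid M"
  shows "limit_carrier M \<lesssim> Pow (Pow (carrier M))"
proof -
  have sub: "x r \<subseteq> carrier M" if "x \<in> limit_carrier M" "r \<in> open_congs M" for x r
    using limit_carrier_class_eq[OF M that] by blast
  have "inj_on (\<lambda>x. x ` open_congs M) (limit_carrier M)"
  proof (rule inj_onI)
    fix x y assume x: "x \<in> limit_carrier M" and y: "y \<in> limit_carrier M"
      and eq: "x ` open_congs M = y ` open_congs M"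
    show "x = y"
    proof (rule limit_carrier_ext[OF x y])
      fix r assume r: "r \<in> open_congs M"
      obtain s where s: "s \<in> open_congs M" "y r = x s"
        using eq r by (metis imageE imageI)
      have rs: "r \<inter> s \<in> open_congs M" by (rule open_congs_Int[OF M r s(1)])
      obtain a where a: "a \<in> carrier M" "a \<in> x (r \<inter> s)"
        by (rule limit_carrier_classE[OF M x rs])
      have "a \<in> x r" "a \<in> x s"
        using limit_carrier_mono[OF x rs r] limit_carrier_mono[OF x rs s(1)]
          open_congs_refl[OF M r a(1)] open_congs_refl[OF M s(1) a(1)] a(2) by blast+
      then show "x r = y r"
        using limit_carrier_class_eq[OF M x r] limit_carrier_class_eq[OF M y r] s(2) by metis
    qed
  qed
  then show ?thesis
    unfolding lepoll_def using sub by (intro exI[of _ "\<lambda>x. x ` open_congs M"]) auto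
qed

section \<open>The 2-category of topological monoids\<close>

lemma smon_hom_cat_simps:
  "Ob (smon_hom_cat M N) = cont_hom M N"
  "(f, a, g) \<in> Ar (smon_hom_cat M N) \<longleftrightarrow>
     f \<in> cont_hom M N \<and> g \<in> cont_hom M N \<and> conjugation M N f a g"
  "src (smon_hom_cat M N) (f, a, g) = f"
  "tgt (smon_hom_cat M N) (f, a, g) = g"
  "ide (smon_hom_cat M N) f = (f, f \<one>\<^bsub>M\<^esub>, f)"
  "cmp (smon_hom_cat M N) (g', b, h) (f, a, g) = (f, b \<otimes>\<^bsub>N\<^esub> a, h)"
  by (simp_all add: smon_hom_cat_def)

lemma smon_two_cat_simps:
  "Obj (smon_two_cat O') = O'"
  "Hom (smon_two_cat O') = smon_hom_cat"
  "id1 (smon_two_cat O') M = (\<lambda>x\<in>carrier M. x)"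
  "comp1 (smon_two_cat O') L M N = compose (carrier L)"
  "comp2 (smon_two_cat O') L M N (f', a', g') (f, a, g) =
     (compose (carrier L) f' f, a' \<otimes>\<^bsub>N\<^esub> f' a, compose (carrier L) g' g)"
  by (simp_all add: smon_two_cat_def)

lemma cont_homD:
  assumes "f \<in> cont_hom M N"
  shows "x \<in> carrier M \<Longrightarrow> f x \<in> carrier N"
    and "x \<in> carrier M \<Longrightarrow> y \<in> carrier M \<Longrightarrow> f (x \<otimes>\<^bsub>M\<^esub> y) = f x \<otimes>\<^bsub>N\<^esub> f y"
    and "f \<in> extensional (carrier M)"
    and "continuous_map (topol M) (topol N) f"
  using assms by (auto simp: cont_hom_def hom_def)

lemma cont_hom_eqI:
  "f \<in> cont_hom M N \<Longrightarrow> g \<in> cont_hom M N \<Longrightarrow> (\<And>x. x \<in> carrier M \<Longrightarrow> f x = g x) \<Longrightarrow> f = g"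
  by (rule extensionalityI[OF cont_homD(3) cont_homD(3)])

lemma cont_hom_restrict:
  assumes M: "topological_monoid M" and f: "f \<in> hom M N" "continuous_map (topol M) (topol N) f"
  shows "restrict f (carrier M) \<in> cont_hom M N"
proof -
  have "continuous_map (topol M) (topol N) (restrict f (carrier M))"
    by (rule continuous_map_eq[OF f(2)]) (simp add: topological_monoidD(2)[OF M])
  with f(1) monoid.m_closed[OF topological_monoidD(1)[OF M]] show ?thesis
    by (auto simp: cont_hom_def hom_def)
qed

lemma cont_hom_compose:
  assumes L: "topological_monoid L" and f: "f \<in> cont_hom L M" and g: "g \<in> cont_hom M N"
  shows "compose (carrier L) g f \<in> cont_hom L N"
proof -
  have "g \<circ> f \<in> hom L N"
    using cont_homD(1,2)[OF f] cont_homD(1,2)[OF g] by (simp add: hom_def)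
  moreover have "continuous_map (topol L) (topol N) (g \<circ> f)"
    by (rule continuous_map_compose[OF cont_homD(4)[OF f] cont_homD(4)[OF g]])
  ultimately show ?thesis
    using cont_hom_restrict[OF L] by (simp add: compose_def o_def)
qed

lemma cont_hom_id: "topological_monoid M \<Longrightarrow> (\<lambda>x\<in>carrier M. x) \<in> cont_hom M M"
  by (rule cont_hom_restrict) (simp_all add: hom_def)

text \<open>Homomorphisms may move the unit, so the identity cell on \<open>f\<close> is carried by
  the idempotent \<open>f(1)\<close>.\<close>

lemma conjugation_id:
  assumes M: "monoid M" and f: "f \<in> cont_hom M N"
  shows "conjugation M N f (f \<one>\<^bsub>M\<^esub>) f"
proof -
  interpret monoid M by (rule M)
  show ?thesis
    unfolding conjugation_def using cont_homD(1)[OF f] by (auto simp flip: cont_homD(2)[OF f])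
qed

lemma conjugation_vcomp:
  assumes M: "monoid M" and N: "monoid N"
    and f: "f \<in> cont_hom M N" and g: "g \<in> cont_hom M N" and h: "h \<in> cont_hom M N"
    and a: "conjugation M N f a g" and b: "conjugation M N g b h"
  shows "conjugation M N f (b \<otimes>\<^bsub>N\<^esub> a) h"
proof -
  interpret M: monoid M by (rule M)
  interpret N: monoid N by (rule N)
  note c = cont_homD(1)[OF f] cont_homD(1)[OF g] cont_homD(1)[OF h]
  have a': "a \<in> carrier N" "a \<otimes>\<^bsub>N\<^esub> f \<one>\<^bsub>M\<^esub> = a" "\<And>m. m \<in> carrier M \<Longrightarrow> a \<otimes>\<^bsub>N\<^esub> f m = g m \<otimes>\<^bsub>N\<^esub> a"
    using a by (auto simp: conjugation_def)
  have b': "b \<in> carrier N" "h \<one>\<^bsub>M\<^esub> \<otimes>\<^bsub>N\<^esub> b = b" "\<And>m. m \<in> carrier M \<Longrightarrow> b \<otimes>\<^bsub>N\<^esub> g m = h m \<otimes>\<^bsub>N\<^esub> b"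
    using b by (auto simp: conjugation_def)
  have "b \<otimes>\<^bsub>N\<^esub> a \<otimes>\<^bsub>N\<^esub> f m = h m \<otimes>\<^bsub>N\<^esub> (b \<otimes>\<^bsub>N\<^esub> a)" if m: "m \<in> carrier M" for m
  proof -
    have "b \<otimes>\<^bsub>N\<^esub> a \<otimes>\<^bsub>N\<^esub> f m = b \<otimes>\<^bsub>N\<^esub> (a \<otimes>\<^bsub>N\<^esub> f m)" using a' b' c m by (simp add: N.m_assoc)
    also have "\<dots> = (b \<otimes>\<^bsub>N\<^esub> g m) \<otimes>\<^bsub>N\<^esub> a" using a' b'(1) c m by (simp add: N.m_assoc)
    also have "\<dots> = (h m \<otimes>\<^bsub>N\<^esub> b) \<otimes>\<^bsub>N\<^esub> a" using b'(3) m by simp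
    also have "\<dots> = h m \<otimes>\<^bsub>N\<^esub> (b \<otimes>\<^bsub>N\<^esub> a)" using a'(1) b'(1) c m by (simp add: N.m_assoc)
    finally show ?thesis .
  qed
  moreover have "b \<otimes>\<^bsub>N\<^esub> a \<otimes>\<^bsub>N\<^esub> f \<one>\<^bsub>M\<^esub> = b \<otimes>\<^bsub>N\<^esub> a"
    using a' b' c by (simp add: N.m_assoc)
  moreover have "h \<one>\<^bsub>M\<^esub> \<otimes>\<^bsub>N\<^esub> (b \<otimes>\<^bsub>N\<^esub> a) = b \<otimes>\<^bsub>N\<^esub> a"
    using a' b' c by (simp flip: N.m_assoc)
  ultimately show ?thesis
    unfolding conjugation_def using a' b' by simp
qed

text \<open>At an element \<open>y\<close> of the middle monoid the equation for \<open>b\<close>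
  reads \<open>b f'(y) = g'(y) b\<close>. It moves \<open>b\<close> past the values of
  \<open>g'\<close>, and what is left is the image under \<open>f'\<close> of the equation for
  \<open>a\<close>.\<close>

lemma conjugation_hcomp:
  assumes L: "monoid L" and N: "monoid N"
    and f: "f \<in> cont_hom L M" and g: "g \<in> cont_hom L M"
    and f': "f' \<in> cont_hom M N" and g': "g' \<in> cont_hom M N"
    and a: "conjugation L M f a g" and b: "conjugation M N f' b g'"
  shows "conjugation L N (compose (carrier L) f' f) (b \<otimes>\<^bsub>N\<^esub> f' a) (compose (carrier L) g' g)"
proof -
  interpret L: monoid L by (rule L)
  interpret N: monoid N by (rule N)
  note c = cont_homD(1)[OF f] cont_homD(1)[OF g] cont_homD(1)[OF f'] cont_homD(1)[OF g']
  note h = cont_homD(2)[OF f', symmetric]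
  have a': "a \<in> carrier M" "a \<otimes>\<^bsub>M\<^esub> f \<one>\<^bsub>L\<^esub> = a" "g \<one>\<^bsub>L\<^esub> \<otimes>\<^bsub>M\<^esub> a = a"
      "\<And>m. m \<in> carrier L \<Longrightarrow> a \<otimes>\<^bsub>M\<^esub> f m = g m \<otimes>\<^bsub>M\<^esub> a"
    using a by (auto simp: conjugation_def)
  have b': "b \<in> carrier N" "\<And>m. m \<in> carrier M \<Longrightarrow> b \<otimes>\<^bsub>N\<^esub> f' m = g' m \<otimes>\<^bsub>N\<^esub> b"
    using b by (auto simp: conjugation_def)
  have l: "b \<otimes>\<^bsub>N\<^esub> f' a \<otimes>\<^bsub>N\<^esub> f' (f m) = b \<otimes>\<^bsub>N\<^esub> f' (a \<otimes>\<^bsub>M\<^esub> f m)" if m: "m \<in> carrier L" for m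
    using a'(1) b'(1) c m by (simp add: N.m_assoc h)
  have r: "g' (g m) \<otimes>\<^bsub>N\<^esub> (b \<otimes>\<^bsub>N\<^esub> f' a) = b \<otimes>\<^bsub>N\<^esub> f' (g m \<otimes>\<^bsub>M\<^esub> a)" if m: "m \<in> carrier L" for m
  proof -
    have "g' (g m) \<otimes>\<^bsub>N\<^esub> (b \<otimes>\<^bsub>N\<^esub> f' a) = (g' (g m) \<otimes>\<^bsub>N\<^esub> b) \<otimes>\<^bsub>N\<^esub> f' a"
      using a'(1) b'(1) c m by (simp add: N.m_assoc)
    also have "\<dots> = (b \<otimes>\<^bsub>N\<^esub> f' (g m)) \<otimes>\<^bsub>N\<^esub> f' a"
      using b'(2) c m by simp
    also have "\<dots> = b \<otimes>\<^bsub>N\<^esub> f' (g m \<otimes>\<^bsub>M\<^esub> a)"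
      using a'(1) b'(1) c m by (simp add: N.m_assoc h)
    finally show ?thesis .
  qed
  show ?thesis
    unfolding conjugation_def using a' b'(1) c by (simp add: compose_eq l r)
qed

lemma is_category_smon_hom_cat:
  assumes M: "monoid M" and N: "monoid N"
  shows "is_category (smon_hom_cat M N)"
proof -
  interpret N: monoid N by (rule N)
  show ?thesis
    unfolding is_category_def
  proof (intro conjI)
    show "\<forall>a\<in>Ar (smon_hom_cat M N). src (smon_hom_cat M N) a \<in> Ob (smon_hom_cat M N) \<and>
        tgt (smon_hom_cat M N) a \<in> Ob (smon_hom_cat M N)"
      by (clarsimp simp: smon_hom_cat_simps)
    show "\<forall>x\<in>Ob (smon_hom_cat M N). ide (smon_hom_cat M N) x \<in> Ar (smon_hom_cat M N) \<and>
        src (smon_hom_cat M N) (ide (smon_hom_cat M N) x) = x \<and>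
        tgt (smon_hom_cat M N) (ide (smon_hom_cat M N) x) = x"
      by (clarsimp simp: smon_hom_cat_simps conjugation_id[OF M])
    show "\<forall>a\<in>Ar (smon_hom_cat M N). \<forall>b\<in>Ar (smon_hom_cat M N).
        src (smon_hom_cat M N) b = tgt (smon_hom_cat M N) a \<longrightarrow>
        cmp (smon_hom_cat M N) b a \<in> Ar (smon_hom_cat M N) \<and>
        src (smon_hom_cat M N) (cmp (smon_hom_cat M N) b a) = src (smon_hom_cat M N) a \<and>
        tgt (smon_hom_cat M N) (cmp (smon_hom_cat M N) b a) = tgt (smon_hom_cat M N) b"
      by (clarsimp simp: smon_hom_cat_simps) (rule conjugation_vcomp[OF M N])
    show "\<forall>a\<in>Ar (smon_hom_cat M N).
        cmp (smon_hom_cat M N) a (ide (smon_hom_cat M N) (src (smon_hom_cat M N) a)) = a \<and>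
        cmp (smon_hom_cat M N) (ide (smon_hom_cat M N) (tgt (smon_hom_cat M N) a)) a = a"
      by (clarsimp simp: smon_hom_cat_simps conjugation_def)
    show "\<forall>a\<in>Ar (smon_hom_cat M N). \<forall>b\<in>Ar (smon_hom_cat M N). \<forall>c\<in>Ar (smon_hom_cat M N).
        src (smon_hom_cat M N) b = tgt (smon_hom_cat M N) a \<and>
        src (smon_hom_cat M N) c = tgt (smon_hom_cat M N) b \<longrightarrow>
        cmp (smon_hom_cat M N) c (cmp (smon_hom_cat M N) b a) =
        cmp (smon_hom_cat M N) (cmp (smon_hom_cat M N) c b) a"
      by (clarsimp simp: smon_hom_cat_simps conjugation_def N.m_assoc)
  qed
qed

lemma prod_cat_simps:
  "Ob (prod_cat C D) = Ob C \<times> Ob D" "Ar (prod_cat C D) = Ar C \<times> Ar D"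
  "src (prod_cat C D) (a, b) = (src C a, src D b)" "tgt (prod_cat C D) (a, b) = (tgt C a, tgt D b)"
  "ide (prod_cat C D) (x, y) = (ide C x, ide D y)"
  "cmp (prod_cat C D) (a', b') (a, b) = (cmp C a' a, cmp D b' b)"
  by (simp_all add: prod_cat_def)

lemma is_categoryD:
  assumes "is_category C"
  shows "a \<in> Ar C \<Longrightarrow> src C a \<in> Ob C" "a \<in> Ar C \<Longrightarrow> tgt C a \<in> Ob C"
    and "x \<in> Ob C \<Longrightarrow> ide C x \<in> Ar C" "x \<in> Ob C \<Longrightarrow> src C (ide C x) = x" "x \<in> Ob C \<Longrightarrow> tgt C (ide C x) = x"
    and "a \<in> Ar C \<Longrightarrow> b \<in> Ar C \<Longrightarrow> src C b = tgt C a \<Longrightarrow> cmp C b a \<in> Ar C"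
    and "a \<in> Ar C \<Longrightarrow> b \<in> Ar C \<Longrightarrow> src C b = tgt C a \<Longrightarrow> src C (cmp C b a) = src C a"
    and "a \<in> Ar C \<Longrightarrow> b \<in> Ar C \<Longrightarrow> src C b = tgt C a \<Longrightarrow> tgt C (cmp C b a) = tgt C b"
    and "a \<in> Ar C \<Longrightarrow> cmp C a (ide C (src C a)) = a" "a \<in> Ar C \<Longrightarrow> cmp C (ide C (tgt C a)) a = a"
    and "a \<in> Ar C \<Longrightarrow> b \<in> Ar C \<Longrightarrow> c \<in> Ar C \<Longrightarrow> src C b = tgt C a \<Longrightarrow> src C c = tgt C b \<Longrightarrow>
      cmp C c (cmp C b a) = cmp C (cmp C c b) a"
  using assms unfolding is_category_def by simp_all

lemma is_category_prod_cat:
  assumes "is_category C" "is_category D"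
  shows "is_category (prod_cat C D)"
  unfolding is_category_def
  by (intro conjI; clarsimp simp: prod_cat_simps is_categoryD[OF assms(1)] is_categoryD[OF assms(2)])

text \<open>Interchange comes down to \<open>b f'(a') = g'(a') b\<close>, the conjugation equation
  of \<open>b\<close> at \<open>a'\<close>.\<close>

lemma is_cat_functor_hcomp:
  assumes L: "topological_monoid L" and M: "topological_monoid M" and N: "topological_monoid N"
  shows "is_cat_functor (prod_cat (smon_hom_cat M N) (smon_hom_cat L M)) (smon_hom_cat L N)
    (\<lambda>(g, f). comp1 (smon_two_cat \<O>) L M N g f) (\<lambda>(b, a). comp2 (smon_two_cat \<O>) L M N b a)"
proof -
  interpret L: monoid L by (rule topological_monoidD(1)[OF L])
  interpret M: monoid M by (rule topological_monoidD(1)[OF M])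
  interpret N: monoid N by (rule topological_monoidD(1)[OF N])
  have interchange: "(b' \<otimes>\<^bsub>N\<^esub> b) \<otimes>\<^bsub>N\<^esub> f' (a' \<otimes>\<^bsub>M\<^esub> a) = (b' \<otimes>\<^bsub>N\<^esub> g' a') \<otimes>\<^bsub>N\<^esub> (b \<otimes>\<^bsub>N\<^esub> f' a)"
    if f': "f' \<in> cont_hom M N" and g': "g' \<in> cont_hom M N"
      and b: "conjugation M N f' b g'" and b': "conjugation M N g' b' h'"
      and a: "conjugation L M f a g" and a': "conjugation L M g a' h"
    for f g h f' g' h' a a' b b'
  proof -
    have c: "a \<in> carrier M" "a' \<in> carrier M" "b \<in> carrier N" "b' \<in> carrier N"
        "f' a \<in> carrier N" "f' a' \<in> carrier N" "g' a' \<in> carrier N"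
      using a a' b b' cont_homD(1)[OF f'] cont_homD(1)[OF g'] by (auto simp: conjugation_def)
    have "b \<otimes>\<^bsub>N\<^esub> f' a' = g' a' \<otimes>\<^bsub>N\<^esub> b" using b c by (simp add: conjugation_def)
    then have "b \<otimes>\<^bsub>N\<^esub> (f' a' \<otimes>\<^bsub>N\<^esub> f' a) = g' a' \<otimes>\<^bsub>N\<^esub> (b \<otimes>\<^bsub>N\<^esub> f' a)"
      using c by (simp flip: N.m_assoc)
    then show ?thesis using c by (simp add: cont_homD(2)[OF f'] N.m_assoc)
  qed
  show ?thesis
    unfolding is_cat_functor_def
  proof (intro conjI)
    show "is_category (prod_cat (smon_hom_cat M N) (smon_hom_cat L M))" "is_category (smon_hom_cat L N)"
      by (intro is_category_prod_cat is_category_smon_hom_cat L.monoid_axioms M.monoid_axioms N.monoid_axioms)+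
  qed (clarsimp simp: prod_cat_simps smon_hom_cat_simps smon_two_cat_simps compose_eq
      cont_hom_compose[OF L] conjugation_hcomp[OF L.monoid_axioms N.monoid_axioms] interchange
      cont_homD(1) simp flip: cont_homD(2))+
qed

lemma strict_2_category_smon_two_cat:
  assumes \<O>: "\<And>M. M \<in> \<O> \<Longrightarrow> topological_monoid M"
  shows "strict_2_category (smon_two_cat \<O>)"
proof -
  note mon = topological_monoidD(1)[OF \<O>]
  have ide: "compose (carrier X) f (\<lambda>x\<in>carrier X. x) = f" "compose (carrier X) (\<lambda>x\<in>carrier Y. x) f = f"
    if f: "f \<in> cont_hom X Y" for X Y f
    using cont_homD(1,3)[OF f] by (auto simp: compose_def fun_eq_iff extensional_def)
  have assoc: "compose (carrier W) h (compose (carrier W) g f) = compose (carrier W) (compose (carrier X) h g) f"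
    if f: "f \<in> cont_hom W X" for W X f g h
    using cont_homD(1)[OF f] by (auto simp: compose_def fun_eq_iff)
  show ?thesis
    unfolding strict_2_category_def smon_two_cat_simps
  proof (intro conjI ballI)
    fix X Y assume X: "X \<in> \<O>" and Y: "Y \<in> \<O>"
    show "is_category (smon_hom_cat X Y)" by (rule is_category_smon_hom_cat[OF mon[OF X] mon[OF Y]])
    fix f assume "f \<in> Ob (smon_hom_cat X Y)"
    then show "compose (carrier X) f (\<lambda>x\<in>carrier X. x) = f" "compose (carrier X) (\<lambda>x\<in>carrier Y. x) f = f"
      by (simp_all add: smon_hom_cat_simps ide)
  next
    fix X assume "X \<in> \<O>"
    then show "(\<lambda>x\<in>carrier X. x) \<in> Ob (smon_hom_cat X X)"
      by (simp add: smon_hom_cat_simps cont_hom_id \<O>)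
  next
    fix X Y Z assume "X \<in> \<O>" "Y \<in> \<O>" "Z \<in> \<O>"
    then show "is_cat_functor (prod_cat (smon_hom_cat Y Z) (smon_hom_cat X Y)) (smon_hom_cat X Z)
        (\<lambda>(g, f). compose (carrier X) g f) (\<lambda>(b, a). comp2 (smon_two_cat \<O>) X Y Z b a)"
      using is_cat_functor_hcomp[OF \<O> \<O> \<O>, of X Y Z \<O>] by (simp only: smon_two_cat_simps)
  next
    fix X Y c assume X: "X \<in> \<O>" and Y: "Y \<in> \<O>" and c: "c \<in> Ar (smon_hom_cat X Y)"
    obtain f a g where [simp]: "c = (f, a, g)" by (cases c)
    have f: "f \<in> cont_hom X Y" "g \<in> cont_hom X Y" and a: "conjugation X Y f a g"
      using c by (simp_all add: smon_hom_cat_simps)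
    \<comment> \<open>This unit law amounts to \<open>a f(1) = a\<close>, a clause of the definition
      of a conjugation, and not to preservation of the unit by \<open>f\<close>.\<close>
    show "comp2 (smon_two_cat \<O>) X X Y c (ide (smon_hom_cat X X) (\<lambda>x\<in>carrier X. x)) = c"
      using f a monoid.one_closed[OF mon[OF X]]
      by (simp add: smon_hom_cat_simps smon_two_cat_simps ide conjugation_def)
    show "comp2 (smon_two_cat \<O>) X Y Y (ide (smon_hom_cat Y Y) (\<lambda>x\<in>carrier Y. x)) c = c"
      using f a monoid.one_closed[OF mon[OF Y]] monoid.l_one[OF mon[OF Y]]
      by (simp add: smon_hom_cat_simps smon_two_cat_simps ide conjugation_def)
  next
    fix W X Y Z f g h assume "f \<in> Ob (smon_hom_cat W X)"
    then show "compose (carrier W) h (compose (carrier W) g f) = compose (carrier W) (compose (carrier X) h g) f"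
      by (simp add: smon_hom_cat_simps assoc)
  next
    fix W X Y Z a b c
    assume W: "W \<in> \<O>" and X: "X \<in> \<O>" and Y: "Y \<in> \<O>" and Z: "Z \<in> \<O>"
      and A: "a \<in> Ar (smon_hom_cat W X)" and B: "b \<in> Ar (smon_hom_cat X Y)" and C: "c \<in> Ar (smon_hom_cat Y Z)"
    obtain f1 a1 g1 f2 a2 g2 f3 a3 g3 where [simp]: "a = (f1, a1, g1)" "b = (f2, a2, g2)" "c = (f3, a3, g3)"
      by (cases a, cases b, cases c)
    have f: "f1 \<in> cont_hom W X" "g1 \<in> cont_hom W X" "f2 \<in> cont_hom X Y" "f3 \<in> cont_hom Y Z"
      and c: "a1 \<in> carrier X" "a2 \<in> carrier Y" "a3 \<in> carrier Z"
      using A B C by (auto simp: smon_hom_cat_simps conjugation_def)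
    show "comp2 (smon_two_cat \<O>) W Y Z c (comp2 (smon_two_cat \<O>) W X Y b a) =
        comp2 (smon_two_cat \<O>) W X Z (comp2 (smon_two_cat \<O>) X Y Z c b) a"
      using f c monoid.m_assoc[OF mon[OF Z]]
      by (simp add: smon_two_cat_simps assoc compose_eq cont_homD(1)[OF f(3)] cont_homD(1)[OF f(4)] cont_homD(2)[OF f(4)])
  qed
qed

section \<open>Reflections and the adjunction\<close>

text \<open>\<open>intertwine\<close> covers both uniqueness of extensions (\<open>a = \<one>\<close>) and the correspondence of
  2-cells.\<close>

definition reflection :: "'a topmonoid \<Rightarrow> 'a topmonoid \<Rightarrow> ('a \<Rightarrow> 'a) \<Rightarrow> bool" where
  "reflection X N v \<longleftrightarrow>
     complete_monoid N \<and> v \<in> cont_hom X N \<and> v \<one>\<^bsub>X\<^esub> = \<one>\<^bsub>N\<^esub> \<and>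
     (\<forall>Y f. complete_monoid Y \<longrightarrow> f \<in> cont_hom X Y \<longrightarrow>
        (\<exists>g\<in>cont_hom N Y. compose (carrier X) g v = f)) \<and>
     (\<forall>Y g h a. complete_monoid Y \<longrightarrow> g \<in> cont_hom N Y \<longrightarrow> h \<in> cont_hom N Y \<longrightarrow> a \<in> carrier Y \<longrightarrow>
        (\<forall>m\<in>carrier X. a \<otimes>\<^bsub>Y\<^esub> g (v m) = h (v m) \<otimes>\<^bsub>Y\<^esub> a) \<longrightarrow>
        (\<forall>x\<in>carrier N. a \<otimes>\<^bsub>Y\<^esub> g x = h x \<otimes>\<^bsub>Y\<^esub> a))"

lemma completed_reflection:
  fixes X N :: "'a topmonoid"
  assumes "completed X N \<pi>"
  shows "reflection X N (completed.unit_map X N \<pi>)"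
proof -
  interpret completed X N \<pi> by (rule assms)
  have "unit_map \<in> hom X N" by (simp add: hom_def unit_map_in unit_map_mult)
  from cont_hom_restrict[OF M this continuous_map_unit_map]
  have v: "unit_map \<in> cont_hom X N" by (simp add: unit_map_def)
  have ext: "\<exists>g\<in>cont_hom N Y. compose (carrier X) g unit_map = f"
    if Y: "complete_monoid Y" and f: "f \<in> cont_hom X Y" for Y f
  proof -
    have "f \<in> hom X Y" using f by (simp add: cont_hom_def)
    then obtain g where g: "g \<in> hom N Y" "continuous_map (topol N) (topol Y) g"
        "\<forall>m\<in>carrier X. g (unit_map m) = f m"
      using ex_extension[OF Y _ cont_homD(4)[OF f]] by blast
    have "compose (carrier X) (restrict g (carrier N)) unit_map = f"
      using g(3) cont_homD(3)[OF f] by (auto simp: compose_def fun_eq_iff extensional_def unit_map_in)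
    with cont_hom_restrict[OF N g(1,2)] show ?thesis by blast
  qed
  have intertwine: "a \<otimes>\<^bsub>Y\<^esub> g x = h x \<otimes>\<^bsub>Y\<^esub> a"
    if Y: "complete_monoid Y" and g: "g \<in> cont_hom N Y" and h: "h \<in> cont_hom N Y" and a: "a \<in> carrier Y"
      and eq: "\<forall>m\<in>carrier X. a \<otimes>\<^bsub>Y\<^esub> g (unit_map m) = h (unit_map m) \<otimes>\<^bsub>Y\<^esub> a"
      and x: "x \<in> carrier N" for Y g h a x
  \<comment> \<open>For fixed \<open>a\<close> both sides are continuous in \<open>x\<close>, though
    in general not homomorphisms; density settles equality of any two continuous maps into a
    Hausdorff space.\<close>
  proof (rule eq_on_dense[OF complete_imp_Hausdorff[OF Y] _ _ _ x])
    note tY = complete_monoidD(1)[OF Y]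
    show "continuous_map (topol N) (topol Y) (\<lambda>x. a \<otimes>\<^bsub>Y\<^esub> g x)"
      by (rule continuous_map_mult_left[OF tY a cont_homD(4)[OF g]])
    show "continuous_map (topol N) (topol Y) (\<lambda>x. h x \<otimes>\<^bsub>Y\<^esub> a)"
      by (rule continuous_map_mult_right[OF tY a cont_homD(4)[OF h]])
  qed (use eq in blast)
  show ?thesis
    unfolding reflection_def using complete v unit_map_one ext intertwine by blast
qed

text \<open>The bound on the limit gives an injection of the completion into \<open>B\<close>; its
  image carries the transported structure and inherits the size bound.\<close>

lemma ex_reflection:
  fixes X :: "'a topmonoid"
  assumes X: "topological_monoid X" and B: "Pow (Pow (carrier X)) \<lesssim> (B :: 'a set)"
  shows "\<exists>N v. carrier N \<lesssim> B \<and> reflection X N v"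
proof -
  note tL = topological_monoid_completion[OF X]
  have "carrier (completion X) \<lesssim> B"
    using lepoll_trans[OF limit_carrier_lepoll[OF X] B] by (simp add: completion_simps)
  then obtain e :: "_ \<Rightarrow> 'a" where e: "inj_on e (carrier (completion X))" "e ` carrier (completion X) \<subseteq> B"
    unfolding lepoll_def by blast
  obtain N \<pi> where N: "carrier N = e ` carrier (completion X)" "topological_monoid N"
      "topmonoid_iso N (completion X) \<pi>"
    using ex_topmonoid_iso_image[OF tL e(1)] by blast
  have "completed X N \<pi>" using X N by (simp add: completed_def)
  from completed_reflection[OF this] show ?thesis
    using N(1) e(2) subset_imp_lepoll by metis
qed

section \<open>From universal arrows to a left 2-adjoint\<close>

text \<open>What follows rests on the universal property of the chosen arrows and no longer on their
  construction. \<open>S\<close> and \<open>D\<close> are separate families because the sources of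
  the arrows and their complete targets may obey different size bounds.\<close>

locale reflective =
  fixes S D :: "'u topmonoid set" and K :: "'u topmonoid \<Rightarrow> 'u topmonoid"
    and v :: "'u topmonoid \<Rightarrow> 'u \<Rightarrow> 'u"
  assumes S: "X \<in> S \<Longrightarrow> topological_monoid X"
    and D: "Y \<in> D \<Longrightarrow> complete_monoid Y"
    and K: "X \<in> S \<Longrightarrow> K X \<in> D"
    and refl: "X \<in> S \<Longrightarrow> reflection X (K X) (v X)"
begin

lemma D': "Y \<in> D \<Longrightarrow> topological_monoid Y"
  by (rule complete_monoidD(1)[OF D])

lemma v:
  assumes "X \<in> S"
  shows "v X \<in> cont_hom X (K X)" "v X \<one>\<^bsub>X\<^esub> = \<one>\<^bsub>K X\<^esub>"
  using refl[OF assms] by (simp_all add: reflection_def)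

lemma intertwine:
  "X \<in> S \<Longrightarrow> Y \<in> D \<Longrightarrow> g \<in> cont_hom (K X) Y \<Longrightarrow> h \<in> cont_hom (K X) Y \<Longrightarrow> a \<in> carrier Y \<Longrightarrow>
    (\<And>m. m \<in> carrier X \<Longrightarrow> a \<otimes>\<^bsub>Y\<^esub> g (v X m) = h (v X m) \<otimes>\<^bsub>Y\<^esub> a) \<Longrightarrow> x \<in> carrier (K X) \<Longrightarrow>
    a \<otimes>\<^bsub>Y\<^esub> g x = h x \<otimes>\<^bsub>Y\<^esub> a"
  using refl[of X] D[of Y] unfolding reflection_def by blast

lemma unique:
  assumes X: "X \<in> S" and Y: "Y \<in> D" and g: "g \<in> cont_hom (K X) Y" and h: "h \<in> cont_hom (K X) Y"
    and eq: "\<And>m. m \<in> carrier X \<Longrightarrow> g (v X m) = h (v X m)"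
  shows "g = h"
proof (rule cont_hom_eqI[OF g h])
  interpret monoid Y by (rule topological_monoidD(1)[OF D'[OF Y]])
  fix x assume x: "x \<in> carrier (K X)"
  have "\<one>\<^bsub>Y\<^esub> \<otimes>\<^bsub>Y\<^esub> g x = h x \<otimes>\<^bsub>Y\<^esub> \<one>\<^bsub>Y\<^esub>"
    by (rule intertwine[OF X Y g h one_closed _ x])
      (simp add: eq cont_homD(1)[OF h] cont_homD(1)[OF v(1)[OF X]])
  then show "g x = h x"
    using cont_homD(1)[OF g x] cont_homD(1)[OF h x] by simp
qed

definition P1 :: "'u topmonoid \<Rightarrow> 'u topmonoid \<Rightarrow> ('u \<Rightarrow> 'u) \<Rightarrow> 'u \<Rightarrow> 'u" where
  "P1 X Y h = compose (carrier X) h (v X)"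

text \<open>The element of a 2-cell lies in \<open>Y\<close>, which precomposition with the unit
  does not touch; only the bounding 1-cells change.\<close>

definition P2 :: "'u topmonoid \<Rightarrow> 'u topmonoid \<Rightarrow> 'u conj_cell \<Rightarrow> 'u conj_cell" where
  "P2 X Y = (\<lambda>(h, a, h'). (P1 X Y h, a, P1 X Y h'))"

text \<open>For a 1-cell \<open>f\<close> between objects of \<open>S\<close> the choice is forced
  by \<open>unique\<close>, hence the functor laws hold strictly.\<close>

definition F1 :: "'u topmonoid \<Rightarrow> 'u topmonoid \<Rightarrow> ('u \<Rightarrow> 'u) \<Rightarrow> 'u \<Rightarrow> 'u" where
  "F1 X Y f = (SOME g. g \<in> cont_hom (K X) (K Y) \<and> P1 X (K Y) g = compose (carrier X) (v Y) f)"

text \<open>On 2-cells the element has to move from \<open>Y\<close> to \<open>K Y\<close>, and the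
  unit of \<open>Y\<close> carries it there.\<close>

definition F :: "('u topmonoid, 'u \<Rightarrow> 'u, 'u conj_cell, 'u topmonoid, 'u \<Rightarrow> 'u, 'u conj_cell) two_functor" where
  "F = \<lparr>on0 = K, on1 = F1, on2 = (\<lambda>X Y (f, a, g). (F1 X Y f, v Y a, F1 X Y g))\<rparr>"

lemma P1_apply: "m \<in> carrier X \<Longrightarrow> P1 X Y h m = h (v X m)"
  by (simp add: P1_def compose_eq)

lemma P1_in: "X \<in> S \<Longrightarrow> h \<in> cont_hom (K X) Y \<Longrightarrow> P1 X Y h \<in> cont_hom X Y"
  unfolding P1_def by (rule cont_hom_compose[OF S v(1)])

lemma bij_P1:
  assumes X: "X \<in> S" and Y: "Y \<in> D"
  shows "bij_betw (P1 X Y) (cont_hom (K X) Y) (cont_hom X Y)"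
  unfolding bij_betw_def
proof
  show "inj_on (P1 X Y) (cont_hom (K X) Y)"
    by (rule inj_onI, rule unique[OF X Y]) (auto simp flip: P1_apply[of _ X Y])
  have "f \<in> P1 X Y ` cont_hom (K X) Y" if f: "f \<in> cont_hom X Y" for f
    using refl[OF X] D[OF Y] f unfolding reflection_def P1_def by blast
  then show "P1 X Y ` cont_hom (K X) Y = cont_hom X Y"
    using P1_in[OF X] by blast
qed

lemma F1:
  assumes X: "X \<in> S" and Y: "Y \<in> S" and f: "f \<in> cont_hom X Y"
  shows "F1 X Y f \<in> cont_hom (K X) (K Y)" "m \<in> carrier X \<Longrightarrow> F1 X Y f (v X m) = v Y (f m)"
proof -
  have "compose (carrier X) (v Y) f \<in> P1 X (K Y) ` cont_hom (K X) (K Y)"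
    using bij_P1[OF X K[OF Y]] cont_hom_compose[OF S[OF X] f v(1)[OF Y]] by (simp add: bij_betw_def)
  then have "\<exists>g. g \<in> cont_hom (K X) (K Y) \<and> P1 X (K Y) g = compose (carrier X) (v Y) f" by auto
  from someI_ex[OF this, folded F1_def]
  have *: "F1 X Y f \<in> cont_hom (K X) (K Y)" "P1 X (K Y) (F1 X Y f) = compose (carrier X) (v Y) f"
    by blast+
  show "F1 X Y f \<in> cont_hom (K X) (K Y)" by (rule *)
  show "F1 X Y f (v X m) = v Y (f m)" if "m \<in> carrier X"
    using fun_cong[OF *(2), of m] that by (simp add: P1_apply compose_eq)
qed

text \<open>The equations at elements of \<open>X\<close> spread to \<open>K X\<close> by
  \<open>intertwine\<close>; the two conditions at the identity agree because \<open>v X\<close>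
  preserves it.\<close>

lemma conjugation_P1:
  assumes X: "X \<in> S" and Y: "Y \<in> D" and g: "g \<in> cont_hom (K X) Y" and h: "h \<in> cont_hom (K X) Y"
  shows "conjugation X Y (P1 X Y g) a (P1 X Y h) \<longleftrightarrow> conjugation (K X) Y g a h"
proof -
  have one: "\<one>\<^bsub>X\<^esub> \<in> carrier X" by (rule monoid.one_closed[OF topological_monoidD(1)[OF S[OF X]]])
  have "(\<forall>m\<in>carrier X. a \<otimes>\<^bsub>Y\<^esub> g (v X m) = h (v X m) \<otimes>\<^bsub>Y\<^esub> a) \<longleftrightarrow>
      (\<forall>x\<in>carrier (K X). a \<otimes>\<^bsub>Y\<^esub> g x = h x \<otimes>\<^bsub>Y\<^esub> a)" if "a \<in> carrier Y"
    using intertwine[OF X Y g h that] cont_homD(1)[OF v(1)[OF X]] by blast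
  then show ?thesis
    unfolding conjugation_def using one by (auto simp: P1_apply v(2)[OF X])
qed

text \<open>Restricted along \<open>v X\<close>, the two 1-cells become the composites of
  \<open>f\<close> and \<open>g\<close> with \<open>v Y\<close>, and the homomorphism
  \<open>v Y\<close> carries the conjugation \<open>a\<close> to one between these composites.
  \<open>conjugation_P1\<close> takes the result back to \<open>K X\<close>.\<close>

lemma conjugation_F1:
  assumes X: "X \<in> S" and Y: "Y \<in> S" and f: "f \<in> cont_hom X Y" and g: "g \<in> cont_hom X Y"
    and a: "conjugation X Y f a g"
  shows "conjugation (K X) (K Y) (F1 X Y f) (v Y a) (F1 X Y g)"
proof -
  have one: "\<one>\<^bsub>X\<^esub> \<in> carrier X" by (rule monoid.one_closed[OF topological_monoidD(1)[OF S[OF X]]])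
  note vY = cont_homD(1,2)[OF v(1)[OF Y]]
  have "conjugation X (K Y) (P1 X (K Y) (F1 X Y f)) (v Y a) (P1 X (K Y) (F1 X Y g))"
    using a one cont_homD(1)[OF f] cont_homD(1)[OF g] unfolding conjugation_def
    by (simp add: P1_apply F1(2)[OF X Y] f g vY(1) flip: vY(2))
  then show ?thesis
    using conjugation_P1[OF X K[OF Y] F1(1)[OF X Y f] F1(1)[OF X Y g]] by blast
qed

lemma F1_id:
  assumes X: "X \<in> S"
  shows "F1 X X (\<lambda>x\<in>carrier X. x) = (\<lambda>x\<in>carrier (K X). x)"
  using F1[OF X X cont_hom_id[OF S[OF X]]] cont_homD(1)[OF v(1)[OF X]]
  by (intro unique[OF X K[OF X]] cont_hom_id D' K X) simp_all

text \<open>Both sides send \<open>v X m\<close> to \<open>v Z (g (f m))\<close>, and homomorphisms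
  from \<open>K X\<close> into \<open>K Z\<close> are determined by such values.\<close>

lemma F1_compose:
  assumes X: "X \<in> S" and Y: "Y \<in> S" and Z: "Z \<in> S" and f: "f \<in> cont_hom X Y" and g: "g \<in> cont_hom Y Z"
  shows "F1 X Z (compose (carrier X) g f) = compose (carrier (K X)) (F1 Y Z g) (F1 X Y f)"
proof (rule unique[OF X K[OF Z]])
  note gf = cont_hom_compose[OF S[OF X] f g]
  show "F1 X Z (compose (carrier X) g f) \<in> cont_hom (K X) (K Z)"
    by (rule F1(1)[OF X Z gf])
  show "compose (carrier (K X)) (F1 Y Z g) (F1 X Y f) \<in> cont_hom (K X) (K Z)"
    by (rule cont_hom_compose[OF D'[OF K[OF X]] F1(1)[OF X Y f] F1(1)[OF Y Z g]])
  show "F1 X Z (compose (carrier X) g f) (v X m) = compose (carrier (K X)) (F1 Y Z g) (F1 X Y f) (v X m)"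
    if m: "m \<in> carrier X" for m
    using m F1(2)[OF X Z gf m] F1(2)[OF X Y f m] F1(2)[OF Y Z g cont_homD(1)[OF f m]]
      cont_homD(1)[OF v(1)[OF X] m] by (simp add: compose_eq)
qed

lemma strict_2_functor_F: "strict_2_functor (smon_two_cat S) (smon_two_cat D) F"
  unfolding strict_2_functor_def smon_two_cat_simps
proof (intro conjI ballI)
  show "strict_2_category (smon_two_cat S)" "strict_2_category (smon_two_cat D)"
    by (simp_all add: strict_2_category_smon_two_cat S D')
  fix X assume X: "X \<in> S"
  show "on0 F X \<in> D" by (simp add: F_def K X)
  show "on1 F X X (\<lambda>x\<in>carrier X. x) = (\<lambda>x\<in>carrier (on0 F X). x)"
    by (simp add: F_def F1_id X)
  fix Y assume Y: "Y \<in> S"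
  have one: "\<one>\<^bsub>X\<^esub> \<in> carrier X" by (rule monoid.one_closed[OF topological_monoidD(1)[OF S[OF X]]])
  \<comment> \<open>Preservation of identity 2-cells: the identity cell on \<open>F1 X Y f\<close>
    has as element its value at the identity, which is the image of \<open>f(1)\<close> because
    \<open>v X\<close> preserves the identity.\<close>
  have vide: "F1 X Y f \<one>\<^bsub>K X\<^esub> = v Y (f \<one>\<^bsub>X\<^esub>)" if "f \<in> cont_hom X Y" for f
    using F1(2)[OF X Y that one] by (simp add: v(2)[OF X])
  show "is_cat_functor (smon_hom_cat X Y) (smon_hom_cat (on0 F X) (on0 F Y)) (on1 F X Y) (on2 F X Y)"
    unfolding is_cat_functor_def
  proof (intro conjI)
    show "is_category (smon_hom_cat X Y)" "is_category (smon_hom_cat (on0 F X) (on0 F Y))"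
      by (simp_all add: is_category_smon_hom_cat topological_monoidD(1) S D' X Y F_def K)
  qed (clarsimp simp: F_def smon_hom_cat_simps F1(1)[OF X Y] vide conjugation_F1[OF X Y];
      simp add: conjugation_def cont_homD(2)[OF v(1)[OF Y]])+
next
  fix X Y Z f g assume X: "X \<in> S" and Y: "Y \<in> S" and Z: "Z \<in> S"
    and f: "f \<in> Ob (smon_hom_cat X Y)" and g: "g \<in> Ob (smon_hom_cat Y Z)"
  show "on1 F X Z (compose (carrier X) g f) = compose (carrier (on0 F X)) (on1 F Y Z g) (on1 F X Y f)"
    using F1_compose[OF X Y Z] f g by (simp add: F_def smon_hom_cat_simps)
next
  fix X Y Z a b assume X: "X \<in> S" and Y: "Y \<in> S" and Z: "Z \<in> S"
    and A: "a \<in> Ar (smon_hom_cat X Y)" and B: "b \<in> Ar (smon_hom_cat Y Z)"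
  obtain f a' g f' b' g' where [simp]: "a = (f, a', g)" "b = (f', b', g')"
    by (cases a, cases b)
  have f: "f \<in> cont_hom X Y" "g \<in> cont_hom X Y" "f' \<in> cont_hom Y Z" "g' \<in> cont_hom Y Z"
    and a: "a' \<in> carrier Y" and b: "b' \<in> carrier Z"
    using A B by (auto simp: smon_hom_cat_simps conjugation_def)
  \<comment> \<open>Horizontal composites: \<open>v Z\<close> is multiplicative, and
    \<open>F1 Y Z f'\<close> extends \<open>v Z\<close> after \<open>f'\<close> along the unit of
    \<open>Y\<close>.\<close>
  have "v Z (b' \<otimes>\<^bsub>Z\<^esub> f' a') = v Z b' \<otimes>\<^bsub>K Z\<^esub> F1 Y Z f' (v Y a')"
    using cont_homD(2)[OF v(1)[OF Z] b cont_homD(1)[OF f(3) a]] F1(2)[OF Y Z f(3) a] by simp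
  then show "on2 F X Z (comp2 (smon_two_cat S) X Y Z b a) =
      comp2 (smon_two_cat D) (on0 F X) (on0 F Y) (on0 F Z) (on2 F Y Z b) (on2 F X Y a)"
    using F1_compose[OF X Y Z f(1,3)] F1_compose[OF X Y Z f(2,4)] by (simp add: F_def smon_two_cat_simps)
qed

text \<open>The element of an arrow is kept, so bijectivity on arrows is bijectivity on the 1-cells
  at both ends together with \<open>conjugation_P1\<close>.\<close>

lemma is_cat_iso_P:
  assumes X: "X \<in> S" and Y: "Y \<in> D"
  shows "is_cat_iso (smon_hom_cat (K X) Y) (smon_hom_cat X Y) (P1 X Y) (P2 X Y)"
  unfolding is_cat_iso_def
proof (intro conjI)
  have one: "\<one>\<^bsub>X\<^esub> \<in> carrier X" by (rule monoid.one_closed[OF topological_monoidD(1)[OF S[OF X]]])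
  have ide: "P1 X Y h \<one>\<^bsub>X\<^esub> = h \<one>\<^bsub>K X\<^esub>" for h
    using one by (simp add: P1_apply v(2)[OF X])
  show "is_cat_functor (smon_hom_cat (K X) Y) (smon_hom_cat X Y) (P1 X Y) (P2 X Y)"
    unfolding is_cat_functor_def
  proof (intro conjI)
    show "is_category (smon_hom_cat (K X) Y)" "is_category (smon_hom_cat X Y)"
      by (simp_all add: is_category_smon_hom_cat topological_monoidD(1) S D' X Y K)
  qed (clarsimp simp: P2_def smon_hom_cat_simps P1_in[OF X] ide conjugation_P1[OF X Y])+
  show "bij_betw (P1 X Y) (Ob (smon_hom_cat (K X) Y)) (Ob (smon_hom_cat X Y))"
    using bij_P1[OF X Y] by (simp add: smon_hom_cat_simps)
  show "bij_betw (P2 X Y) (Ar (smon_hom_cat (K X) Y)) (Ar (smon_hom_cat X Y))"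
    unfolding bij_betw_def
  proof
    have inj: "g = h" if "g \<in> cont_hom (K X) Y" "h \<in> cont_hom (K X) Y" "P1 X Y g = P1 X Y h" for g h
      using bij_P1[OF X Y] that by (auto simp: bij_betw_def inj_on_def)
    show "inj_on (P2 X Y) (Ar (smon_hom_cat (K X) Y))"
      by (rule inj_onI) (clarsimp simp: P2_def smon_hom_cat_simps inj)
    show "P2 X Y ` Ar (smon_hom_cat (K X) Y) = Ar (smon_hom_cat X Y)"
    proof
      show "P2 X Y ` Ar (smon_hom_cat (K X) Y) \<subseteq> Ar (smon_hom_cat X Y)"
        by (clarsimp simp: P2_def smon_hom_cat_simps P1_in[OF X] conjugation_P1[OF X Y])
      show "Ar (smon_hom_cat X Y) \<subseteq> P2 X Y ` Ar (smon_hom_cat (K X) Y)"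
      proof
        fix c assume c: "c \<in> Ar (smon_hom_cat X Y)"
        obtain f a g where [simp]: "c = (f, a, g)" by (cases c)
        have "f \<in> P1 X Y ` cont_hom (K X) Y" "g \<in> P1 X Y ` cont_hom (K X) Y"
          using c bij_P1[OF X Y] by (simp_all add: smon_hom_cat_simps bij_betw_def)
        then obtain f' g' where fg: "f' \<in> cont_hom (K X) Y" "g' \<in> cont_hom (K X) Y" "f = P1 X Y f'" "g = P1 X Y g'"
          by blast
        then have "(f', a, g') \<in> Ar (smon_hom_cat (K X) Y)" "c = P2 X Y (f', a, g')"
          using c conjugation_P1[OF X Y fg(1,2)] by (simp_all add: smon_hom_cat_simps P2_def)
        then show "c \<in> P2 X Y ` Ar (smon_hom_cat (K X) Y)" by blast
      qed
    qed
  qed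
qed

lemma strict_2_functor_inclusion:
  assumes C: "\<And>X. X \<in> C \<Longrightarrow> topological_monoid X" and DC: "D \<subseteq> C"
  shows "strict_2_functor (smon_two_cat D) (smon_two_cat C) inclusion"
proof -
  have "is_cat_functor (smon_hom_cat X Y) (smon_hom_cat X Y) (\<lambda>f. f) (\<lambda>a. a)" if "X \<in> D" "Y \<in> D" for X Y
  proof -
    have "is_category (smon_hom_cat X Y)"
      by (simp add: is_category_smon_hom_cat topological_monoidD(1) D' that)
    then show ?thesis unfolding is_cat_functor_def by (simp add: is_categoryD)
  qed
  moreover have "comp2 (smon_two_cat D) = comp2 (smon_two_cat C)"
    by (simp add: smon_two_cat_def)
  ultimately show ?thesis
    unfolding strict_2_functor_def inclusion_def
    using strict_2_category_smon_two_cat[OF D'] strict_2_category_smon_two_cat[OF C] DC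
    by (simp add: smon_two_cat_simps subset_iff)
qed

text \<open>On the carrier both sides send \<open>m\<close> to
  \<open>g (h (v X (f m)))\<close>.\<close>

lemma P1_natural:
  assumes X: "X \<in> S" and X': "X' \<in> S" and f: "f \<in> cont_hom X' X" and h: "h \<in> cont_hom (K X) Y"
  shows "P1 X' Y' (compose (carrier (K X')) g (compose (carrier (K X')) h (F1 X' X f))) =
    compose (carrier X') g (compose (carrier X') (P1 X Y h) f)"
proof
  fix m
  show "P1 X' Y' (compose (carrier (K X')) g (compose (carrier (K X')) h (F1 X' X f))) m =
    compose (carrier X') g (compose (carrier X') (P1 X Y h) f) m"
  proof (cases "m \<in> carrier X'")
    case m: True
    then show ?thesis
      using cont_homD(1)[OF v(1)[OF X'] m] cont_homD(1)[OF f m] F1(2)[OF X' X f m]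
      by (simp add: P1_apply compose_eq)
  \<comment> \<open>Off the carrier both sides are \<open>undefined\<close>.\<close>
  qed (simp add: P1_def compose_def)
qed

theorem left_adjoint_data:
  assumes C: "\<And>X. X \<in> C \<Longrightarrow> topological_monoid X" and SC: "S \<subseteq> C" and DC: "D \<subseteq> C"
  shows "left_adjoint_data_on S (smon_two_cat D) (smon_two_cat C) inclusion F P1 P2"
  unfolding left_adjoint_data_on_def
proof (intro conjI ballI)
  show "S \<subseteq> Obj (smon_two_cat C)" using SC by (simp add: smon_two_cat_simps)
  show "strict_2_functor (smon_two_cat D) (smon_two_cat C) inclusion"
    by (rule strict_2_functor_inclusion[OF C DC])
  have "full_sub (smon_two_cat C) S = smon_two_cat S"
    by (simp add: full_sub_def smon_two_cat_def)
  then show "strict_2_functor (full_sub (smon_two_cat C) S) (smon_two_cat D) F"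
    using strict_2_functor_F by simp
  fix X assume X: "X \<in> S"
  show "is_cat_iso (Hom (smon_two_cat D) (on0 F X) Y) (Hom (smon_two_cat C) X (on0 inclusion Y)) (P1 X Y) (P2 X Y)"
    if "Y \<in> Obj (smon_two_cat D)" for Y
    using that is_cat_iso_P[OF X] by (simp add: smon_two_cat_simps F_def inclusion_def)
  fix X' Y Y' assume X': "X' \<in> S"
  show "P1 X' Y' (comp1 (smon_two_cat D) (on0 F X') Y Y' g
          (comp1 (smon_two_cat D) (on0 F X') (on0 F X) Y h (on1 F X' X f))) =
        comp1 (smon_two_cat C) X' (on0 inclusion Y) (on0 inclusion Y') (on1 inclusion Y Y' g)
          (comp1 (smon_two_cat C) X' X (on0 inclusion Y) (P1 X Y h) f)"
    if "f \<in> Ob (Hom (smon_two_cat C) X' X)" "h \<in> Ob (Hom (smon_two_cat D) (on0 F X) Y)" for f g h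
    using that by (simp add: smon_two_cat_simps smon_hom_cat_simps F_def inclusion_def P1_natural[OF X X'])
  show "P2 X' Y' (comp2 (smon_two_cat D) (on0 F X') Y Y' b
          (comp2 (smon_two_cat D) (on0 F X') (on0 F X) Y c (on2 F X' X a))) =
        comp2 (smon_two_cat C) X' (on0 inclusion Y) (on0 inclusion Y') (on2 inclusion Y Y' b)
          (comp2 (smon_two_cat C) X' X (on0 inclusion Y) (P2 X Y c) a)"
    if A: "a \<in> Ar (Hom (smon_two_cat C) X' X)" and c: "c \<in> Ar (Hom (smon_two_cat D) (on0 F X) Y)" for a b c
  proof -
    obtain f a' f' g b' g' h c' h' where [simp]: "a = (f, a', f')" "b = (g, b', g')" "c = (h, c', h')"
      by (cases a, cases b, cases c)
    have "f \<in> cont_hom X' X" "f' \<in> cont_hom X' X" "a' \<in> carrier X" "h \<in> cont_hom (K X) Y" "h' \<in> cont_hom (K X) Y"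
      using A c by (auto simp: smon_two_cat_simps smon_hom_cat_simps F_def conjugation_def)
    \<comment> \<open>The 1-cells at both ends are covered by \<open>P1_natural\<close>. The
      elements are \<open>b' g(c' h(v X a'))\<close> and \<open>b' g(c' P1 X Y h a')\<close>, equal
      because \<open>P1 X Y h\<close> is \<open>h\<close> after \<open>v X\<close> on the
      carrier.\<close>
    then show ?thesis
      by (simp add: smon_two_cat_simps F_def inclusion_def P2_def P1_natural[OF X X'] P1_apply)
  qed
qed

end

section \<open>Size bounds and the adjunction for the inclusion\<close>

text \<open>A set in \<open>V\<close> dominating the double power set of the carrier makes room for
  the completion, and closure of \<open>V\<close> under smaller sets puts the copy of the completion
  among the \<open>V\<close>-small monoids. The universal arrows are then chosen for all objects at
  once.\<close>

lemma has_left_adjoint_on_enlargement: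
  fixes U V :: "'u set set"
  assumes UV: "enlargement U V"
  shows "has_left_adjoint_on (Obj (PMon U)) (CMon V) (PMon V) inclusion"
proof -
  let ?S = "{M. carrier M \<in> U \<and> powder_monoid M}" and ?D = "{M. carrier M \<in> V \<and> complete_monoid M}"
    and ?C = "{M. carrier M \<in> V \<and> powder_monoid M}"
  have top: "topological_monoid M" if "powder_monoid M" for M :: "'u topmonoid"
    using that by (simp add: powder_monoid_def)
  have "\<forall>X\<in>?S. \<exists>p. fst p \<in> ?D \<and> reflection X (fst p) (snd p)"
  proof
    fix X assume X: "X \<in> ?S"
    obtain B where B: "B \<in> V" "Pow (Pow (carrier X)) \<lesssim> B"
      using UV X unfolding enlargement_def by blast
    have "topological_monoid X" using X top by blast
    then obtain N v where N: "carrier N \<lesssim> B" "reflection X N v"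
      using ex_reflection[OF _ B(2)] by blast
    then have "carrier N \<in> V" using UV B(1) unfolding enlargement_def by blast
    with N(2) have "N \<in> ?D" by (simp add: reflection_def)
    with N(2) show "\<exists>p. fst p \<in> ?D \<and> reflection X (fst p) (snd p)"
      by (intro exI[of _ "(N, v)"]) simp
  qed
  from bchoice[OF this] obtain p where
    p: "\<forall>X\<in>?S. fst (p X) \<in> ?D \<and> reflection X (fst (p X)) (snd (p X))" by blast
  interpret reflective ?S ?D "\<lambda>X. fst (p X)" "\<lambda>X. snd (p X)"
  proof
    fix X assume X: "X \<in> ?S"
    show "topological_monoid X" using X top by blast
    show "fst (p X) \<in> ?D" "reflection X (fst (p X)) (snd (p X))"
      using bspec[OF p X] by (rule conjunct1, rule conjunct2)
  qed simp
  have "?S \<subseteq> ?C" using UV unfolding enlargement_def by blast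
  moreover have "?D \<subseteq> ?C" using complete_imp_powder by blast
  ultimately have "left_adjoint_data_on ?S (smon_two_cat ?D) (smon_two_cat ?C) inclusion F P1 P2"
    by (intro left_adjoint_data) (auto simp: top)
  then show ?thesis
    unfolding has_left_adjoint_on_def PMon_def CMon_def smon_two_cat_simps by blast
qed

text \<open>A universe is an enlargement of itself, so the first conjunct is the enlargement
  statement with \<open>V = U\<close>.\<close>

theorem mainTheorem20:
  fixes U V :: "'u set set"
  shows "(universe U \<longrightarrow> has_left_adjoint (CMon U) (PMon U) inclusion) \<and>
         (enlargement U V \<longrightarrow> has_left_adjoint_on (Obj (PMon U)) (CMon V) (PMon V) inclusion)"
  unfolding has_left_adjoint_def using has_left_adjoint_on_enlargement enlargement_self by blast

end
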